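(* Let $\alpha,\beta$ be positive real constants. Consider measurable functions $f:\mathbb{R}^{p,q}\to Cl(p,q)$ satisfying, for some positive constant $C$, the estimates $$|f(x)|\le C e^{-\alpha|x|^2}\quad (x\in\mathbb{R}^{p,q}),\qquad |\mathcal{F}^i\{f\}(y)|\le C e^{-\beta|y|^2}\quad (y\in\mathbb{R}^{p,q}).\qquad( * )$$ Then: (1) If $\alpha\beta>\frac14$, then every $f$ satisfying $( * )$ is $0$ (almost everywhere). (2) If $\alpha\beta=\frac14$, then every $f$ satisfying $( * )$ is of the form $f(x)=Ae^{-\alpha|x|^2}$ (for almost every $x$), with $A\in Cl(p,q)$ a constant. (3) If $\alpha\beta<\frac14$, then there exist infinitely many functions $f$ satisfying $( * )$.
   Context: Let $n=p+q\ge 1$. $Cl(p,q)$ is the real associative unital Clifford algebra generated by $e_1,\dots,e_n$ with $e_ke_l+e_le_k=2\epsilon_k\delta_{k,l}$, where $\epsilon_k=+1$ for $1\le k\le p$ and $\epsilon_k=-1$ for $p+1\le k\le n$. It has the basis $e_A=e_{i_1}\cdots e_{i_k}$, $A=\{i_1<\cdots<i_k\}\subseteq\{1,\dots,n\}$, $e_\emptyset=1$; elements are written $M=\sum_A M_Ae_A$ with $M_A\in\mathbb{R}$, and $\langle M\rangle_k$ denotes the grade-$k$ part. The scalar product is $M\ast N=\langle MN\rangle_0$. The principal reverse is $\widetilde{M}=\sum_{k=0}^n(-1)^{k(k-1)/2}\,\overline{\langle M\rangle_k}$, where the bar is linear with $\overline{e_{i_1}\cdots e_{i_k}}=\epsilon_{i_1}e_{i_1}\cdots\epsilon_{i_k}e_{i_k}$;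 one has $M\ast\widetilde N=\sum_AM_AN_A$, and the modulus is $|M|^2=M\ast\widetilde M=\sum_AM_A^2$. Vectors $x\in\mathbb{R}^{p,q}$ are identified with $x=\sum_{l}x_le^l=\sum_l x^le_l$, where $e^l=\epsilon_le_l$ (so $x^l=\epsilon_lx_l$), and $|x|^2=\sum_l x_l^2$. $d^nx=dx_1\cdots dx_n$ is Lebesgue measure. Fix $i\in Cl(p,q)$ with $i^2=-1$ and $\widetilde i=-i$. For $f\in L^1(\mathbb{R}^{p,q},Cl(p,q))$ the Clifford Fourier transform with respect to $i$ is $$\mathcal{F}^i\{f\}(w)=\int_{\mathbb{R}^{p,q}}f(x)e^{-iu(x,w)}\,d^nx,\qquad u(x,w)=x\ast\widetilde w=\sum_{l=1}^nx_lw_l,$$ where $e^{-i\theta}=\cos\theta-i\sin\theta$ for $\theta\in\mathbb{R}$. *)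

theory Defs
  imports "HOL-Analysis.Analysis"
begin

text \<open>
  The index set \<open>{1,\<dots>,n}\<close> is a finite linearly ordered type \<open>'n\<close>, with \<open>n = CARD('n)\<close>.
  An element \<open>M = (\<Sum>A. M\<^sub>A e\<^sub>A)\<close> of \<open>Cl(p,q)\<close>, \<open>p + q = n\<close>, is the vector of its \<open>2 ^ n\<close>
  coefficients \<open>M\<^sub>A = M $ A\<close>. The instance of multiplication and unit that the library
  provides on vectors is componentwise and is not the Clifford one; the algebra structure of
  \<open>Cl(p,q)\<close> is \<open>cl_mult p\<close> and \<open>cl_one\<close> below. The addition, scaling, norm and topology are those
  of the library.
\<close>

type_synonym 'n clifford = "(real, 'n set) vec"

type_synonym 'n coords = "(real, 'n) vec"

text \<open>The set \<open>{j. j \<le> k}\<close> has \<open>k\<close> elements when \<open>k\<close> is read as a number in \<open>{1,\<dots>,n}\<close>.\<close>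

definition eps :: "nat \<Rightarrow> 'n::{finite,linorder} \<Rightarrow> real" where
  "eps p k = (if card {j. j \<le> k} \<le> p then 1 else -1)"

definition cl_basis :: "'n::{finite,linorder} set \<Rightarrow> 'n clifford" where
  "cl_basis A = axis A 1"

definition cl_one :: "'n::{finite,linorder} clifford" where
  "cl_one = cl_basis {}"

definition cl_gen :: "'n::{finite,linorder} \<Rightarrow> 'n clifford" where
  "cl_gen k = cl_basis {k}"

text \<open>
  Sorting the word \<open>e\<^sub>A e\<^sub>B\<close> moves each factor \<open>e\<^sub>b\<close> of \<open>e\<^sub>B\<close> to the left past the larger factors
  \<open>e\<^sub>a\<close> of \<open>e\<^sub>A\<close> (a factor \<open>-1\<close> each); the pairs \<open>a = b\<close> are contracted to \<open>e\<^sub>a e\<^sub>a = \<epsilon>\<^sub>a\<close>.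
  Hence \<open>e\<^sub>A e\<^sub>B = cl_sign p A B e\<^sub>C\<close> with \<open>C\<close> the symmetric difference of \<open>A\<close> and \<open>B\<close>.
  The lemmas \<open>cl_mult_assoc\<close>, \<open>cl_gen_anticommute\<close> and \<open>cl_basis_eq_prod_gen\<close> confirm
  that this is the Clifford algebra with its standard basis.
\<close>

definition cl_sign :: "nat \<Rightarrow> 'n::{finite,linorder} set \<Rightarrow> 'n set \<Rightarrow> real" where
  "cl_sign p A B =
     (\<Prod>a\<in>A. \<Prod>b\<in>B. if b < a then -1 else if a = b then eps p a else 1)"

definition cl_mult ::
  "nat \<Rightarrow> 'n::{finite,linorder} clifford \<Rightarrow> 'n clifford \<Rightarrow> 'n clifford" where
  "cl_mult p M N =
     (\<Sum>A\<in>UNIV. \<Sum>B\<in>UNIV. (M $ A * N $ B * cl_sign p A B) *\<^sub>R cl_basis ((A - B) \<union> (B - A)))"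

definition cl_grade :: "nat \<Rightarrow> 'n::{finite,linorder} clifford \<Rightarrow> 'n clifford" where
  "cl_grade k M = (\<Sum>A | card A = k. M $ A *\<^sub>R cl_basis A)"

text \<open>The scalar part, as a real number: the only set of cardinality 0 is the empty one.\<close>

definition cl_scalar_prod :: "nat \<Rightarrow> 'n::{finite,linorder} clifford \<Rightarrow> 'n clifford \<Rightarrow> real" where
  "cl_scalar_prod p M N = cl_grade 0 (cl_mult p M N) $ {}"

definition cl_bar :: "nat \<Rightarrow> 'n::{finite,linorder} clifford \<Rightarrow> 'n clifford" where
  "cl_bar p M = (\<Sum>A\<in>UNIV. (M $ A * (\<Prod>k\<in>A. eps p k)) *\<^sub>R cl_basis A)"

definition cl_reverse :: "nat \<Rightarrow> 'n::{finite,linorder} clifford \<Rightarrow> 'n clifford" where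
  "cl_reverse p M =
     (\<Sum>k = 0..CARD('n). (-1) ^ (k * (k - 1) div 2) *\<^sub>R cl_bar p (cl_grade k M))"

definition cl_modulus :: "nat \<Rightarrow> 'n::{finite,linorder} clifford \<Rightarrow> real" where
  "cl_modulus p M = sqrt (cl_scalar_prod p M (cl_reverse p M))"

text \<open>
  A vector is given by its lower coordinates \<open>x\<^sub>l = x $ l\<close>, that is \<open>x = (\<Sum>l. x\<^sub>l e\<^sup>l)\<close> with
  \<open>e\<^sup>l = \<epsilon>\<^sub>l e\<^sub>l\<close>; these are the coordinates of \<open>d\<^sup>nx = dx\<^sub>1 \<dots> dx\<^sub>n\<close>.
\<close>

definition cl_vec :: "nat \<Rightarrow> 'n::{finite,linorder} coords \<Rightarrow> 'n clifford" where
  "cl_vec p x = (\<Sum>l\<in>UNIV. x $ l *\<^sub>R (eps p l *\<^sub>R cl_gen l))"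

definition cl_phase :: "nat \<Rightarrow> 'n::{finite,linorder} coords \<Rightarrow> 'n coords \<Rightarrow> real" where
  "cl_phase p x w = cl_scalar_prod p (cl_vec p x) (cl_reverse p (cl_vec p w))"

text \<open>\<open>cl_kernel i \<theta>\<close> is \<open>e\<^bsup>-i\<theta>\<^esup>\<close>; it is used for \<open>i\<close> with \<open>cl_mult p i i = - cl_one\<close>.\<close>

definition cl_kernel :: "'n::{finite,linorder} clifford \<Rightarrow> real \<Rightarrow> 'n clifford" where
  "cl_kernel i \<theta> = cos \<theta> *\<^sub>R cl_one - sin \<theta> *\<^sub>R i"

definition cl_fourier ::
  "nat \<Rightarrow> 'n::{finite,linorder} clifford \<Rightarrow> ('n coords \<Rightarrow> 'n clifford) \<Rightarrow> 'n coords \<Rightarrow> 'n clifford"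
  where "cl_fourier p i f w =
     integral\<^sup>L lebesgue (\<lambda>x. cl_mult p (f x) (cl_kernel i (cl_phase p x w)))"

text \<open>
  The first estimate makes a measurable \<open>f\<close> integrable, so the Fourier transform in the second one
  is that of an \<open>L\<^sup>1\<close> function.
\<close>

definition hardy_estimates ::
  "nat \<Rightarrow> 'n::{finite,linorder} clifford \<Rightarrow> real \<Rightarrow> real \<Rightarrow> ('n coords \<Rightarrow> 'n clifford) \<Rightarrow> bool"
  where "hardy_estimates p i \<alpha> \<beta> f \<longleftrightarrow>
     f \<in> borel_measurable lebesgue \<and>
     (\<exists>C>0. (\<forall>x. cl_modulus p (f x) \<le> C * exp (- \<alpha> * (norm x)\<^sup>2)) \<and>
            (\<forall>y. cl_modulus p (cl_fourier p i f y) \<le> C * exp (- \<beta> * (norm y)\<^sup>2)))"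


lemma cl_basis_nth: "cl_basis A $ B = (if A = B then 1 else 0)"
  by (auto simp: cl_basis_def axis_def)

lemma clifford_expansion: "(\<Sum>A\<in>UNIV. M $ A *\<^sub>R cl_basis A) = M"
  by (simp add: vec_eq_iff cl_basis_nth if_distrib cong: if_cong)

lemma bilinear_cl_mult: "bilinear (cl_mult p)"
  unfolding bilinear_def
  by (intro conjI allI linearI)
    (simp_all add: cl_mult_def algebra_simps scaleR_sum_right sum.distrib)

lemma cl_mult_basis:
  "cl_mult p (cl_basis A) (cl_basis B) = cl_sign p A B *\<^sub>R cl_basis ((A - B) \<union> (B - A))"
proof -
  have "cl_mult p (cl_basis A) (cl_basis B) =
     (\<Sum>A'\<in>UNIV. \<Sum>B'\<in>UNIV. if B' = B then (if A' = A then cl_sign p A B *\<^sub>R cl_basis ((A - B) \<union> (B - A)) else 0) else 0)"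
    unfolding cl_mult_def by (intro sum.cong refl) (simp add: cl_basis_nth)
  then show ?thesis by simp
qed

lemma eps_square: "eps p k * eps p k = 1"
  by (simp add: eps_def)

lemma prod_symdiff:
  fixes g :: "'a::finite \<Rightarrow> real"
  assumes "\<And>a. g a * g a = 1"
  shows "prod g ((A - B) \<union> (B - A)) = prod g A * prod g B"
proof -
  have 1: "prod g ((A - B) \<union> (B - A)) = prod g (A - B) * prod g (B - A)"
    by (rule prod.union_disjoint) auto
  have 2: "prod g A = prod g (A - B) * prod g (A \<inter> B)" for A B
    by (metis finite mult.commute prod.Int_Diff)
  have 3: "prod g (A \<inter> B) * prod g (A \<inter> B) = 1"
    by (simp add: prod.distrib[symmetric] assms)
  have "prod g A * prod g B =
      prod g (A - B) * prod g (B - A) * (prod g (A \<inter> B) * prod g (A \<inter> B))"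
    by (subst 2[of A B], subst 2[of B A]) (simp add: Int_commute)
  then show ?thesis using 1 3 by simp
qed

lemma cl_sign_symdiff_left: 
  "cl_sign p ((A - B) \<union> (B - A)) C = cl_sign p A C * cl_sign p B C"
  unfolding cl_sign_def
  by (rule prod_symdiff) (auto simp: eps_square simp flip: prod.distrib intro!: prod.neutral)

lemma cl_sign_swap:
  "cl_sign p A B = (\<Prod>b\<in>B. \<Prod>a\<in>A. if b < a then -1 else if a = b then eps p a else 1)"
  unfolding cl_sign_def by (rule prod.swap)

lemma cl_sign_symdiff_right:
  "cl_sign p A ((B - C) \<union> (C - B)) = cl_sign p A B * cl_sign p A C"
  unfolding cl_sign_swap
  by (rule prod_symdiff) (auto simp: eps_square simp flip: prod.distrib intro!: prod.neutral)

lemma cl_mult_basis_assoc: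
  "cl_mult p (cl_mult p (cl_basis A) (cl_basis B)) (cl_basis C) =
   cl_mult p (cl_basis A) (cl_mult p (cl_basis B) (cl_basis C))"
proof -
  have "((A - B) \<union> (B - A)) - C \<union> (C - ((A - B) \<union> (B - A))) =
    (A - ((B - C) \<union> (C - B))) \<union> (((B - C) \<union> (C - B)) - A)" by blast
  then show ?thesis
    by (simp add: cl_mult_basis bilinear_lmul[OF bilinear_cl_mult]
        bilinear_rmul[OF bilinear_cl_mult] cl_sign_symdiff_left cl_sign_symdiff_right)
qed

lemma clifford_linear_eq:
  fixes F G :: "'n::{finite,linorder} clifford \<Rightarrow> 'b::real_vector"
  assumes "linear F" "linear G" "\<And>A. F (cl_basis A) = G (cl_basis A)"
  shows "F M = G M"
proof -
  have "H M = (\<Sum>A\<in>UNIV. M $ A *\<^sub>R H (cl_basis A))" if "linear H"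
    for H :: "'n clifford \<Rightarrow> 'b"
    by (subst clifford_expansion[of M, symmetric])
      (simp only: linear_sum[OF that] linear_cmul[OF that])
  from this[OF assms(1)] this[OF assms(2)] show ?thesis by (simp add: assms(3))
qed

lemma linear_cl_mult_left: "linear (\<lambda>M. cl_mult p M N)"
  and linear_cl_mult_right: "linear (cl_mult p N)"
  using bilinear_cl_mult by (auto simp: bilinear_def)

theorem cl_mult_assoc: "cl_mult p (cl_mult p L M) N = cl_mult p L (cl_mult p M N)"
proof -
  note lin = linear_cl_mult_left linear_cl_mult_right
    linear_compose[OF linear_cl_mult_left linear_cl_mult_left, unfolded o_def]
    linear_compose[OF linear_cl_mult_left linear_cl_mult_right, unfolded o_def]
    linear_compose[OF linear_cl_mult_right linear_cl_mult_left, unfolded o_def]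
    linear_compose[OF linear_cl_mult_right linear_cl_mult_right, unfolded o_def]
  have 1: "cl_mult p (cl_mult p (cl_basis A) (cl_basis B)) N =
      cl_mult p (cl_basis A) (cl_mult p (cl_basis B) N)" for A B
    by (rule clifford_linear_eq[where M = N]) (intro lin cl_mult_basis_assoc)+
  have 2: "cl_mult p (cl_mult p (cl_basis A) M) N = cl_mult p (cl_basis A) (cl_mult p M N)" for A
    by (rule clifford_linear_eq[where M = M]) (intro lin 1)+
  show ?thesis
    by (rule clifford_linear_eq[where M = L]) (intro lin 2)+
qed

theorem cl_mult_one_left: "cl_mult p cl_one M = M"
  and cl_mult_one_right: "cl_mult p M cl_one = M"
proof -
  show "cl_mult p cl_one M = M"
    by (rule clifford_linear_eq[where G = "\<lambda>M. M"])
      (auto simp: linear_cl_mult_right cl_one_def cl_mult_basis cl_sign_def linear_iff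
        bilinear_radd[OF bilinear_cl_mult] bilinear_rmul[OF bilinear_cl_mult])
  show "cl_mult p M cl_one = M"
    by (rule clifford_linear_eq[where G = "\<lambda>M. M"])
      (auto simp: cl_one_def cl_mult_basis cl_sign_def linear_iff
        bilinear_ladd[OF bilinear_cl_mult] bilinear_lmul[OF bilinear_cl_mult])
qed

theorem cl_gen_anticommute:
  "cl_mult p (cl_gen k) (cl_gen l) + cl_mult p (cl_gen l) (cl_gen k) =
   (2 * eps p k * (if k = l then 1 else 0)) *\<^sub>R cl_one"
proof (cases "k = l")
  case True
  then show ?thesis
    by (simp add: cl_gen_def cl_mult_basis cl_sign_def cl_one_def scaleR_2 flip: scaleR_scaleR)
next
  case False
  then have "({k} - {l}) \<union> ({l} - {k}) = {k, l}" "({l} - {k}) \<union> ({k} - {l}) = {k, l}" by auto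
  with False show ?thesis
    by (auto simp: cl_gen_def cl_mult_basis cl_sign_def)
qed

theorem cl_basis_eq_prod_gen:
  "cl_basis A = foldr (cl_mult p) (map cl_gen (sorted_list_of_set A)) cl_one"
proof -
  have "foldr (cl_mult p) (map cl_gen ks) cl_one = cl_basis (set ks)"
    if "sorted_wrt (<) ks" for ks :: "'a list"
    using that
  proof (induction ks)
    case Nil
    then show ?case by (simp add: cl_one_def)
  next
    case (Cons k ks)
    then have lt: "\<forall>l\<in>set ks. k < l" by simp
    then have "({k} - set ks) \<union> (set ks - {k}) = insert k (set ks)" by auto
    moreover have "cl_sign p {k} (set ks) = 1"
      using lt by (force simp: cl_sign_def intro!: prod.neutral)
    ultimately show ?case using Cons by (simp add: cl_gen_def cl_mult_basis)
  qed
  then show ?thesis using strict_sorted_list_of_set[of A] by simp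
qed

lemma cl_sign_self:
  "cl_sign p A A = (-1) ^ (card A * (card A - 1) div 2) * (\<Prod>k\<in>A. eps p k)"
proof -
  have "finite A" by simp
  then show ?thesis
  proof (induction A rule: finite_linorder_max_induct)
    case empty
    then show ?case by (simp add: cl_sign_def)
  next
    case (insert m A)
    let ?s = "\<lambda>a b. if b < a then -1 else if a = b then eps p a else (1::real)"
    have m: "m \<notin> A" using insert by blast
    have row: "(\<Prod>b\<in>A. ?s m b) = (-1) ^ card A"
      using insert(2) by (simp cong: prod.cong)
    have "(\<Prod>b\<in>insert m A. ?s a b) = (\<Prod>b\<in>A. ?s a b)" if "a \<in> A" for a
      using insert(2) that m by (auto simp: not_less_iff_gr_or_eq)
    then have "(\<Prod>a\<in>A. \<Prod>b\<in>insert m A. ?s a b) = cl_sign p A A"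
      unfolding cl_sign_def by (rule prod.cong[OF refl])
    then have "cl_sign p (insert m A) (insert m A) = eps p m * (-1) ^ card A * cl_sign p A A"
      unfolding cl_sign_def[of p "insert m A"]
      by (subst prod.insert) (use m row in simp_all)
    moreover have "card (insert m A) * (card (insert m A) - 1) div 2
        = card A + card A * (card A - 1) div 2"
      using m by (cases "card A") (auto simp: algebra_simps)
    ultimately show ?case using insert m by (simp add: power_add)
  qed
qed

lemma cl_reverse_nth: "cl_reverse p M $ A = cl_sign p A A * M $ A"
proof -
  have grade: "cl_grade k M $ A = (if card A = k then M $ A else 0)" for k
    by (simp add: cl_grade_def cl_basis_nth if_distrib cong: if_cong)
  have bar: "cl_bar p N $ A = N $ A * (\<Prod>k\<in>A. eps p k)" for N
    by (simp add: cl_bar_def cl_basis_nth if_distrib cong: if_cong)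
  have "cl_reverse p M $ A =
      (\<Sum>k = 0..CARD('a). if k = card A then (-1) ^ (k * (k - 1) div 2) * (M $ A * (\<Prod>k\<in>A. eps p k)) else 0)"
    unfolding cl_reverse_def sum_component vector_scaleR_component bar grade
    by (intro sum.cong) auto
  also have "\<dots> = cl_sign p A A * M $ A"
    by (simp add: cl_sign_self card_mono)
  finally show ?thesis .
qed

theorem cl_scalar_prod_reverse: "cl_scalar_prod p M (cl_reverse p N) = (\<Sum>A\<in>UNIV. M $ A * N $ A)"
proof -
  have grade0: "cl_grade 0 L $ {} = L $ {}" for L :: "'a clifford"
    by (simp add: cl_grade_def cl_basis_nth)
  have sq: "cl_sign p A A * cl_sign p A A = 1" for A :: "'a set"
    unfolding cl_sign_def by (auto simp: eps_square simp flip: prod.distrib intro!: prod.neutral)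
  have "cl_scalar_prod p M (cl_reverse p N) =
      (\<Sum>A\<in>UNIV. \<Sum>B\<in>UNIV. if B = A then M $ A * N $ A * (cl_sign p A A * cl_sign p A A) else 0)"
    unfolding cl_scalar_prod_def grade0 cl_mult_def sum_component vector_scaleR_component
    by (intro sum.cong refl) (auto simp: cl_basis_nth cl_reverse_nth)
  then show ?thesis by (simp add: sq)
qed

theorem cl_modulus_eq_norm: "cl_modulus p M = norm M"
  by (simp add: cl_modulus_def cl_scalar_prod_reverse norm_eq_sqrt_inner inner_vec_def)

theorem cl_phase_eq_inner:
  fixes x w :: "'a::{finite,linorder} coords"
  shows "cl_phase p x w = x \<bullet> w"
proof -
  have nth: "cl_vec p x $ A = (\<Sum>l\<in>UNIV. if {l} = A then x $ l * eps p l else 0)"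
    for x :: "'a coords" and A
    unfolding cl_vec_def cl_gen_def by (auto simp: cl_basis_nth intro!: sum.cong)
  have single: "cl_vec p x $ {l} = x $ l * eps p l" for x :: "'a coords" and l
    unfolding nth by simp
  have "cl_phase p x w = (\<Sum>A\<in>UNIV. cl_vec p x $ A * cl_vec p w $ A)"
    by (simp add: cl_phase_def cl_scalar_prod_reverse)
  also have "\<dots> = (\<Sum>A\<in>range (\<lambda>l. {l}). cl_vec p x $ A * cl_vec p w $ A)"
    by (rule sum.mono_neutral_right) (auto simp: nth intro!: sum.neutral)
  also have "\<dots> = (\<Sum>l\<in>UNIV. cl_vec p x $ {l} * cl_vec p w $ {l})"
    by (subst sum.reindex) auto
  also have "\<dots> = (\<Sum>l\<in>UNIV. x $ l * w $ l * (eps p l * eps p l))"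
    by (simp add: single mult_ac)
  finally show ?thesis by (simp add: eps_square inner_vec_def)
qed

end

theory Submission
  imports Defs "HOL-Complex_Analysis.Conformal_Mappings" "HOL-Probability.Characteristic_Functions"
    "HOL-Real_Asymp.Real_Asymp"
begin

text \<open>
  Right multiplication by \<open>i\<close> is a complex structure on \<open>Cl(p,q)\<close>: for each basis element \<open>e\<^sub>A\<close> the map
  \<open>\<Phi>(M) = M\<^sub>A - \<i> (M i)\<^sub>A\<close> turns it into multiplication by the complex unit \<open>\<i>\<close>. Applied to the values
  of \<open>f\<close>, this map turns the Clifford Fourier transform into the ordinary one of the complex function
  \<open>\<Phi> \<circ> f\<close> and preserves both Gaussian bounds up to a constant factor, and \<open>f\<^sub>A\<close> is the real part of \<open>\<Phi> \<circ> f\<close>. So the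
  critical case \<open>\<alpha>\<beta> = 1/4\<close> is Hardy's theorem for a complex function \<open>g\<close> on a Euclidean space
  (\<open>hardy_critical\<close>).

  That theorem is reduced to functions of one complex variable. For a direction \<open>w\<close>, the Gaussian
  decay of \<open>g\<close> makes \<open>F(z) = \<integral> g(x) e\<^bsup>-\<i> z x\<bullet>w\<^esup> dx\<close> an entire function bounded by a multiple of
  \<open>exp(b (Im z)\<^sup>2)\<close> with \<open>b = |w|\<^sup>2/(4\<alpha>)\<close>, and \<open>F(t)\<close> is the Fourier transform at \<open>t w\<close>. Hence
  \<open>G(z) = F(z) exp(b z\<^sup>2)\<close> is bounded by a multiple of \<open>exp(b (Re z)\<^sup>2)\<close> everywhere and, by the bound
  on the transform, is bounded on the real axis. On the imaginary axis the growth bound is a constant, so \<open>G\<close> is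
  bounded on the boundary of each quadrant. The order \<open>2\<close> of \<open>G\<close> is exactly critical for the
  opening \<open>\<pi>/2\<close>; a Phragmen-Lindelof argument on smaller sectors that exhaust the quadrant still
  shows that \<open>G\<close> is bounded (\<open>critical_growth_quadrant\<close>), so it is constant by Liouville. Comparing
  \<open>z = 1\<close> with \<open>z = 0\<close> shows that the Fourier transform of \<open>g\<close> is that of a Gaussian, and \<open>g\<close> is
  this Gaussian since the Fourier transform is injective (\<open>fourier_eq_0_imp_AE_eq_0\<close>).

  If \<open>\<alpha>\<beta> > 1/4\<close>, the critical case with a smaller \<open>\<beta>\<close> gives \<open>f(x) = e\<^bsup>-\<alpha>|x|\<^sup>2\<^esup> A\<close>; its transform
  decays exactly like \<open>e\<^bsup>-|y|\<^sup>2/(4\<alpha>)\<^esup>\<close>, which is slower than \<open>e\<^bsup>-\<beta>|y|\<^sup>2\<^esup>\<close> unless \<open>A = 0\<close>.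
  If \<open>\<alpha>\<beta> < 1/4\<close>, the Gaussians \<open>e\<^bsup>-\<gamma>|x|\<^sup>2\<^esup>\<close> with \<open>\<alpha> \<le> \<gamma> \<le> 1/(4\<beta>)\<close> satisfy both estimates.
\<close>

section \<open>Entire functions of critical growth on the plane\<close>

lemma Re_powr_sector:
  assumes z: "Re z > 0" "\<bar>Im z\<bar> \<le> tan \<phi> * Re z"
    and \<phi>: "0 < \<phi>" "\<phi> < pi/2" and \<rho>: "0 < \<rho>" "\<rho> * \<phi> \<le> pi/2"
  shows "Re (z powr of_real \<rho>) \<ge> norm z powr \<rho> * cos (\<rho> * \<phi>)"
proof -
  have "z \<noteq> 0" using z by auto
  have "\<bar>Im z / Re z\<bar> \<le> tan \<phi>" using z by (simp add: field_simps abs_divide)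
  then have "arctan \<bar>Im z / Re z\<bar> \<le> arctan (tan \<phi>)" by (simp only: arctan_monotone')
  also have "arctan (tan \<phi>) = \<phi>" using \<phi> by (simp add: arctan_tan)
  finally have Arg: "\<bar>Arg z\<bar> \<le> \<phi>"
    using arg_conv_arctan[OF z(1)] by (metis abs_arctan)
  have "Re (z powr of_real \<rho>) = norm z powr \<rho> * cos (\<rho> * Arg z)"
    using \<open>z \<noteq> 0\<close> by (simp add: powr_def Re_exp Ln_Arg)
  moreover have "cos (\<rho> * Arg z) = cos \<bar>\<rho> * Arg z\<bar>" by simp
  moreover have "\<bar>\<rho> * Arg z\<bar> \<le> \<rho> * \<phi>" using Arg \<rho> by (simp add: abs_mult)
  moreover have "\<rho> * \<phi> \<le> pi" using \<rho> pi_gt_zero by linarith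
  ultimately show ?thesis
    by (metis abs_ge_zero cos_monotone_0_pi_le mult_left_mono powr_ge_zero)
qed

text \<open>
  The opening \<open>2 \<phi> < \<pi>/2\<close> leaves room for an exponent \<open>\<rho> > 2\<close> with \<open>\<rho> \<phi> < \<pi>/2\<close>. The function
  \<open>exp(- e (1 + w)\<^bsup>\<rho>\<^esup>)\<close> is then at most \<open>1\<close> in modulus on the sector and beats growth of order \<open>2\<close> on
  large arcs, so the maximum principle applies to its product with \<open>H\<close>; finally \<open>e\<close> tends to \<open>0\<close>.
  The shift by \<open>1\<close> keeps the base of the power away from the branch point at the vertex.
\<close>

lemma phragmen_lindelof_sector:
  fixes H :: "complex \<Rightarrow> complex"
  assumes H: "H holomorphic_on UNIV" and \<phi>: "0 < \<phi>" "\<phi> < pi/4"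
    and growth: "\<And>w. \<bar>Im w\<bar> \<le> tan \<phi> * Re w \<Longrightarrow> norm (H w) \<le> B * exp (a * (norm w)\<^sup>2)"
    and edge: "\<And>w. \<bar>Im w\<bar> = tan \<phi> * Re w \<Longrightarrow> norm (H w) \<le> C"
    and w: "\<bar>Im w\<bar> \<le> tan \<phi> * Re w"
  shows "norm (H w) \<le> C"
proof -
  \<comment> \<open>The midpoint of \<open>2\<close> and \<open>pi / (2 * \<phi>)\<close>.\<close>
  define \<rho> where "\<rho> = 1 + pi / (4 * \<phi>)"
  have \<rho>: "\<rho> > 2" "\<rho> * \<phi> < pi/2"
    using \<phi> by (auto simp: \<rho>_def field_simps)
  define d where "d = cos (\<rho> * \<phi>)"
  have d: "d > 0" unfolding d_def using \<rho> \<phi> by (intro cos_gt_zero) auto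
  have t: "tan \<phi> > 0" using \<phi> by (intro tan_gt_zero) auto
  define M where "M e w = exp (- of_real e * (1 + w) powr of_real \<rho>)" for e :: real and w :: complex
  have norm_M: "norm (M e w) \<le> exp (- e * d * norm (1 + w) powr \<rho>)"
      and pos: "Re (1 + w) > 0"
    if "e > 0" "\<bar>Im w\<bar> \<le> tan \<phi> * Re w" for e w
  proof -
    have "0 \<le> tan \<phi> * Re w" using that(2) by linarith
    with t have "Re w \<ge> 0" by (simp add: zero_le_mult_iff)
    then show *: "Re (1 + w) > 0" by simp
    have "\<bar>Im (1 + w)\<bar> \<le> tan \<phi> * Re (1 + w)" using that(2) t by (simp add: algebra_simps)
    then have "Re ((1 + w) powr of_real \<rho>) \<ge> norm (1 + w) powr \<rho> * d"
      unfolding d_def using \<phi> \<rho> by (intro Re_powr_sector *) auto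
    then show "norm (M e w) \<le> exp (- e * d * norm (1 + w) powr \<rho>)"
      using that(1) by (simp add: M_def mult.assoc mult.commute mult_left_mono)
  qed
  have C0: "C \<ge> 0" using edge[of 0] norm_ge_zero[of "H 0"] by (simp del: norm_ge_zero)
  have B0: "B \<ge> 0" using growth[of 0] norm_ge_zero[of "H 0"] by (simp del: norm_ge_zero)
  have cpos: "norm (H w * M e w) \<le> C'" if e: "e > 0" and C': "C' > C" for e C'
  proof -
    define A s where "A = \<bar>a\<bar> + 1" and "s = e * d"
    have A: "A > 0" "a \<le> A" and s: "s > 0" using e d by (auto simp: A_def s_def)
    have "((\<lambda>R. exp (A * R\<^sup>2 - s * R powr \<rho>)) \<longlongrightarrow> 0) at_top"
      using \<rho>(1) A(1) s by real_asymp
    from tendsto_mult_right_zero[OF this, of B]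
    have lim: "((\<lambda>R. B * exp (A * R\<^sup>2 - e * d * R powr \<rho>)) \<longlongrightarrow> 0) at_top"
      by (simp add: s_def)
    have "eventually (\<lambda>R. B * exp (A * R\<^sup>2 - e * d * R powr \<rho>) < C') at_top"
      by (rule order_tendstoD(2)[OF lim]) (use C0 C' in linarith)
    then obtain R where R: "R > norm w" "B * exp (A * R\<^sup>2 - e * d * R powr \<rho>) < C'"
      using eventually_happens'[OF trivial_limit_at_top_linorder
          eventually_conj[OF _ eventually_gt_at_top[of "norm w"]]] by blast
    define K where "K = {w. \<bar>Im w\<bar> \<le> tan \<phi> * Re w} \<inter> cball 0 R"
    have sec: "closed {w. \<bar>Im w\<bar> \<le> tan \<phi> * Re w}"
      by (intro closed_Collect_le continuous_intros)
    have osec: "open {w. \<bar>Im w\<bar> < tan \<phi> * Re w}"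
      by (intro open_Collect_less continuous_intros)
    have K: "closed K" unfolding K_def by (intro closed_Int sec closed_cball)
    have intK: "{w. \<bar>Im w\<bar> < tan \<phi> * Re w} \<inter> ball 0 R \<subseteq> interior K"
      unfolding K_def by (intro interior_maximal open_Int osec) auto
    have hol: "(\<lambda>w. H w * M e w) holomorphic_on K"
    proof -
      have "w \<in> K \<Longrightarrow> 1 + w \<notin> \<real>\<^sub>\<le>\<^sub>0" for w
        using pos[OF e, of w] by (auto simp: K_def complex_nonpos_Reals_iff)
      then show ?thesis unfolding M_def
        by (intro holomorphic_intros holomorphic_on_subset[OF H]) auto
    qed
    show ?thesis
    proof (rule maximum_modulus_frontier[of "\<lambda>w. H w * M e w" K])
      show "(\<lambda>w. H w * M e w) holomorphic_on interior K"
        using hol by (rule holomorphic_on_subset) (rule interior_subset)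
      show "continuous_on (closure K) (\<lambda>w. H w * M e w)"
        using hol K by (simp add: holomorphic_on_imp_continuous_on)
      show "bounded K" unfolding K_def by (simp add: bounded_Int)
      show "w \<in> K" using w R by (auto simp: K_def)
      fix z assume "z \<in> frontier K"
      then have z: "z \<in> K" "z \<notin> interior K" using K by (auto simp: frontier_def)
      then have zs: "\<bar>Im z\<bar> \<le> tan \<phi> * Re z" and zR: "norm z \<le> R" by (auto simp: K_def)
      have "norm z \<le> norm (1 + z)"
      proof -
        have "Re z \<ge> 0" using pos[OF e zs] zs t by (smt (verit) mult_pos_neg)
        then show ?thesis unfolding cmod_def by (intro real_sqrt_le_mono add_mono) (auto simp: power2_eq_square algebra_simps)
      qed
      then have M: "norm (M e z) \<le> exp (- e * d * norm z powr \<rho>)"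
        using norm_M[OF e zs] e d \<rho> 
        by (smt (verit, best) exp_le_cancel_iff mult_le_cancel_left mult_pos_pos mult_minus_left norm_ge_zero powr_mono2)
      consider "\<bar>Im z\<bar> = tan \<phi> * Re z" | "norm z = R"
        using z(2) intK zs zR by force
      then show "norm (H z * M e z) \<le> C'"
      proof cases
        case 1
        have "norm (M e z) \<le> 1" using M e d
          by (smt (verit, best) exp_le_one_iff mult_nonneg_nonneg mult_minus_left powr_ge_zero)
        then have "norm (H z) * norm (M e z) \<le> C * 1" using edge[OF 1] C0 by (intro mult_mono) auto
        then show ?thesis using C' by (simp add: norm_mult)
      next
        case 2
        have "norm (H z * M e z) \<le> (B * exp (A * R\<^sup>2)) * exp (- e * d * R powr \<rho>)"
          unfolding norm_mult
        proof (intro mult_mono)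
          have "norm (H z) \<le> B * exp (a * (norm z)\<^sup>2)" by (rule growth[OF zs])
          also have "\<dots> \<le> B * exp (A * (norm z)\<^sup>2)" using B0 A by (intro mult_left_mono) (auto intro!: mult_right_mono)
          finally show "norm (H z) \<le> B * exp (A * R\<^sup>2)" using 2 by simp
        qed (use M 2 B0 in auto)
        also have "\<dots> = B * exp (A * R\<^sup>2 - e * d * R powr \<rho>)" by (simp add: exp_diff exp_minus field_simps)
        finally show ?thesis using R by simp
      qed
    qed
  qed
  have le: "norm (H w * M e w) \<le> C" if "e > 0" for e
    by (rule dense_ge) (rule cpos[OF that])
  have "((\<lambda>e. norm (H w * M e w)) \<longlongrightarrow> norm (H w * M 0 w)) (at_right 0)"
    unfolding M_def by (intro tendsto_intros)
  then have "norm (H w * M 0 w) \<le> C"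
    by (rule tendsto_upperbound) (auto simp: eventually_at_right_less le intro!: eventually_mono[OF eventually_at_right_less])
  then show ?thesis by (simp add: M_def)
qed

text \<open>
  The factor \<open>exp(\<i> b z\<^sup>2)\<close> has modulus \<open>1\<close> on the real axis and modulus \<open>exp(- 2 b Re z Im z)\<close> in
  general. On the ray of angle \<open>2 \<phi> < \<pi>/2\<close> the choice \<open>b = a cot(2 \<phi>) / 2\<close> makes it cancel the
  growth of \<open>G\<close> exactly, so that the Phragmen-Lindelof principle on the sector between the real axis
  and this ray gives \<open>norm (G z) \<le> C * exp (2 * b * Re z * Im z)\<close>. As \<open>2 \<phi>\<close> tends to \<open>\<pi>/2\<close>, \<open>b\<close>
  tends to \<open>0\<close>.
\<close>

lemma critical_growth_quadrant:
  fixes G :: "complex \<Rightarrow> complex"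
  assumes G: "G holomorphic_on UNIV" and a: "a \<ge> 0"
    and growth: "\<And>z. norm (G z) \<le> C * exp (a * (Re z)\<^sup>2)"
    and real: "\<And>t. norm (G (of_real t)) \<le> C"
    and z: "Re z \<ge> 0" "Im z \<ge> 0"
  shows "norm (G z) \<le> C"
proof (cases "Re z = 0 \<or> Im z = 0")
  case True
  then show ?thesis
  proof
    assume "Im z = 0"
    then have "z = of_real (Re z)" by (simp add: complex_eq_iff)
    then show ?thesis using real[of "Re z"] by simp
  qed (use growth[of z] in simp)
next
  case False
  then have z: "Re z > 0" "Im z > 0" using z by auto
  have C0: "C \<ge> 0" using real[of 0] norm_ge_zero[of "G 0"] by (simp del: norm_ge_zero)
  define b where "b \<phi> = a * cos (2 * \<phi>) / (2 * sin (2 * \<phi>))" for \<phi> :: real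
  have bound: "norm (G z) \<le> C * exp (2 * b \<phi> * Re z * Im z)"
    if \<phi>: "arctan (Im z / Re z) / 2 < \<phi>" "\<phi> < pi/4" for \<phi>
  proof -
    have at: "arctan (Im z / Re z) > 0" using z by (simp add: zero_less_arctan_iff)
    then have \<phi>0: "\<phi> > 0" using \<phi> by linarith
    have s: "sin \<phi> > 0" "cos \<phi> > 0" "sin (2*\<phi>) > 0" "cos (2 * \<phi>) > 0"
      using \<phi>0 \<phi> by (auto intro!: sin_gt_zero cos_gt_zero)
    have b0: "b \<phi> \<ge> 0" using s a by (simp add: b_def)
    \<comment> \<open>Rotated by \<open>\<phi>\<close>, so that the sector is symmetric about the real axis.\<close>
    define H where "H w = G (w * cis \<phi>) * exp (\<i> * of_real (b \<phi>) * (w * cis \<phi>)\<^sup>2)" for w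
    have nH: "norm (H w) = norm (G (w * cis \<phi>)) * exp (- 2 * b \<phi> * Re (w * cis \<phi>) * Im (w * cis \<phi>))" for w
      by (simp add: H_def norm_mult power2_eq_square algebra_simps)
    have re: "Re (w * cis \<phi>) = Re w * cos \<phi> - Im w * sin \<phi>" 
      and im: "Im (w * cis \<phi>) = Re w * sin \<phi> + Im w * cos \<phi>" for w by auto
    have sector: "Re w \<ge> 0 \<and> Re (w * cis \<phi>) \<ge> 0 \<and> Im (w * cis \<phi>) \<ge> 0"
      if "\<bar>Im w\<bar> \<le> tan \<phi> * Re w" for w
    proof -
      have "0 \<le> tan \<phi> * Re w" using that by linarith
      moreover have t: "tan \<phi> > 0" using s by (simp add: tan_def)
      ultimately have r: "Re w \<ge> 0" by (simp add: zero_le_mult_iff)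
      have u: "\<bar>Im w\<bar> * cos \<phi> \<le> sin \<phi> * Re w" using that s by (simp add: tan_def field_simps)
      have im0: "Im (w * cis \<phi>) \<ge> 0" unfolding im using u s
        by (smt (verit) mult.commute mult_minus_left mult_right_mono)
      have "sin \<phi> \<le> cos \<phi>"
        using sin_cos_eq[of \<phi>] cos_monotone_0_pi_le[of \<phi> "pi/2 - \<phi>"] \<phi>0 \<phi> by auto
      then have "Im w * sin \<phi> \<le> \<bar>Im w\<bar> * cos \<phi>" using s by (intro mult_mono) auto
      also note u
      also have "sin \<phi> * Re w \<le> cos \<phi> * Re w" using \<open>sin \<phi> \<le> cos \<phi>\<close> r by (rule mult_right_mono)
      finally have "Re (w * cis \<phi>) \<ge> 0" unfolding re by (simp add: mult.commute)
      then show ?thesis using r im0 by auto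
    qed
    have "norm (H (z * cis (-\<phi>))) \<le> C"
    proof (rule phragmen_lindelof_sector[where H = H and \<phi> = \<phi> and a = a and B = C])
      show "H holomorphic_on UNIV" unfolding H_def
        by (intro holomorphic_intros holomorphic_on_compose_gen[OF _ G, unfolded o_def]) auto
      show "norm (H w) \<le> C * exp (a * (norm w)\<^sup>2)" if "\<bar>Im w\<bar> \<le> tan \<phi> * Re w" for w
      proof -
        have "norm (H w) \<le> norm (G (w * cis \<phi>)) * 1"
          unfolding nH using sector[OF that] b0 by (intro mult_left_mono) auto
        also have "\<dots> \<le> C * exp (a * (Re (w * cis \<phi>))\<^sup>2)" using growth[of "w * cis \<phi>"] by (simp del: times_complex.sel)
        also have "(Re (w * cis \<phi>))\<^sup>2 \<le> (norm w)\<^sup>2"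
          using abs_Re_le_cmod[of "w * cis \<phi>"] by (simp add: norm_mult abs_le_square_iff[symmetric])
        finally show ?thesis using C0 a by (smt (verit) exp_le_cancel_iff mult_left_mono)
      qed
      show "norm (H w) \<le> C" if e: "\<bar>Im w\<bar> = tan \<phi> * Re w" for w
      proof (cases "Im w \<ge> 0")
        case True
        then have iw: "Im w = sin \<phi> / cos \<phi> * Re w" using e by (simp add: tan_def)
        have 1: "Im (w * cis \<phi>) = 2 * Re w * sin \<phi>" unfolding im iw using s by (simp add: field_simps)
        have 2: "Re (w * cis \<phi>) = Re w * cos (2 * \<phi>) / cos \<phi>" unfolding re iw cos_double using s
          by (simp add: field_simps power2_eq_square)
        have "a * Re (w * cis \<phi>) = 2 * b \<phi> * Im (w * cis \<phi>)"
          unfolding 1 2 b_def using s by (simp add: field_simps) (simp add: sin_double[of \<phi>] mult.commute[of _ 2])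
        then have "a * (Re (w * cis \<phi>))\<^sup>2 = 2 * b \<phi> * Re (w * cis \<phi>) * Im (w * cis \<phi>)"
          by (metis (no_types, lifting) mult.assoc mult.commute power2_eq_square)
        then have "norm (H w) = norm (G (w * cis \<phi>)) * exp (- (a * (Re (w * cis \<phi>))\<^sup>2))"
          unfolding nH by (simp del: times_complex.sel)
        then show ?thesis using growth[of "w * cis \<phi>"]
          by (simp add: exp_minus pos_divide_le_eq del: times_complex.sel flip: divide_inverse)
      next
        case False
        then have iw: "Im w = - sin \<phi> / cos \<phi> * Re w" using e by (simp add: tan_def)
        have "Im (w * cis \<phi>) = 0" unfolding im iw using s by simp
        then have "w * cis \<phi> = of_real (Re (w * cis \<phi>))" by (simp add: complex_eq_iff)
        then show ?thesis unfolding nH using real[of "Re (w * cis \<phi>)"] \<open>Im (w * cis \<phi>) = 0\<close> by simp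
      qed
      have "Im z / Re z = tan (arctan (Im z / Re z))" by (simp add: tan_arctan)
      also have "\<dots> \<le> tan (2 * \<phi>)" using \<phi> at pi_gt_zero by (intro tan_mono_le) linarith+
      finally have "Im z * cos (2*\<phi>) \<le> sin (2*\<phi>) * Re z" using z s by (simp add: tan_def field_simps)
      moreover have "Im z * cos \<phi> - Re z * sin \<phi> \<le> tan \<phi> * (Re z * cos \<phi> + Im z * sin \<phi>)
         \<longleftrightarrow> Im z * cos (2*\<phi>) \<le> sin (2*\<phi>) * Re z"
        unfolding cos_double sin_double using s by (simp add: tan_def field_simps power2_eq_square)
      moreover have "- (Im z * cos \<phi> - Re z * sin \<phi>) \<le> tan \<phi> * (Re z * cos \<phi> + Im z * sin \<phi>)"
      proof -
        have "- (Im z * cos \<phi>) \<le> tan \<phi> * (Im z * sin \<phi>)" using z s 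
          by (smt (verit) divide_pos_pos mult_pos_pos tan_def)
        moreover have "Re z * sin \<phi> = tan \<phi> * (Re z * cos \<phi>)" using s by (simp add: tan_def)
        ultimately show ?thesis by (smt (verit) distrib_left)
      qed
      ultimately show "\<bar>Im (z * cis (-\<phi>))\<bar> \<le> tan \<phi> * Re (z * cis (-\<phi>))" by (auto simp: abs_le_iff)
    qed (use \<phi> \<phi>0 in auto)
    moreover have "z * cis (-\<phi>) * cis \<phi> = z" by (simp add: mult.assoc cis_mult)
    ultimately have "norm (G z) * exp (- (2 * b \<phi> * Re z * Im z)) \<le> C"
      unfolding nH by (simp only: mult_minus_left)
    then show ?thesis by (simp add: exp_minus pos_divide_le_eq flip: divide_inverse)
  qed
  have "((\<lambda>\<phi>. C * exp (2 * b \<phi> * Re z * Im z)) \<longlongrightarrow> C * exp (2 * b (pi/4) * Re z * Im z)) (at_left (pi/4))"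
    unfolding b_def by (intro tendsto_intros) auto
  moreover have "eventually (\<lambda>\<phi>. norm (G z) \<le> C * exp (2 * b \<phi> * Re z * Im z)) (at_left (pi/4))"
  proof -
    have "arctan (Im z / Re z) / 2 < pi/4" using arctan_ubound[of "Im z / Re z"] by simp
    then show ?thesis
      by (rule eventually_at_left_field[THEN iffD2, OF exI, OF conjI]) (use bound in auto)
  qed
  ultimately have "norm (G z) \<le> C * exp (2 * b (pi/4) * Re z * Im z)"
    by (intro tendsto_lowerbound) auto
  then show ?thesis by (simp add: b_def)
qed

text \<open>
  The hypotheses are invariant under complex conjugation and under \<open>z \<mapsto> - z\<close>, which carry the bound
  from the first quadrant to the whole plane.
\<close>

lemma critical_growth_constant:
  fixes G :: "complex \<Rightarrow> complex"
  assumes G: "G holomorphic_on UNIV" and a: "a \<ge> 0"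
    and growth: "\<And>z. norm (G z) \<le> C * exp (a * (Re z)\<^sup>2)"
    and real: "\<And>t. norm (G (of_real t)) \<le> C"
  shows "G z = G 0"
proof -
  have up: "norm (F z) \<le> C"
    if F: "F holomorphic_on UNIV" "\<And>z. norm (F z) \<le> C * exp (a * (Re z)\<^sup>2)" "\<And>t. norm (F (of_real t)) \<le> C"
      and z: "Re z \<ge> 0" for F :: "complex \<Rightarrow> complex" and z
  proof (cases "Im z \<ge> 0")
    case True
    then show ?thesis using critical_growth_quadrant[OF F(1) a F(2,3)] z by auto
  next
    case False
    have "norm ((cnj \<circ> F \<circ> cnj) (cnj z)) \<le> C"
    proof (rule critical_growth_quadrant[where G = "cnj \<circ> F \<circ> cnj", OF _ a])
      show "cnj \<circ> F \<circ> cnj holomorphic_on UNIV"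
        by (rule holomorphic_on_compose_cnj_cnj) (auto intro: holomorphic_on_subset[OF F(1)])
    qed (use False z F(2)[of "cnj _"] F(3) in auto)
    then show ?thesis by simp
  qed
  have "norm (G z) \<le> C" for z
  proof (cases "Re z \<ge> 0")
    case True
    then show ?thesis using up[OF G growth real] by auto
  next
    case False
    have "norm ((G \<circ> uminus) (- z)) \<le> C"
    proof (rule up[where F = "G \<circ> uminus"])
      show "G \<circ> uminus holomorphic_on UNIV"
        by (intro holomorphic_on_compose_gen[OF _ G] holomorphic_intros) auto
    qed (use False growth[of "- _"] real[of "- _"] in auto)
    then show ?thesis by simp
  qed
  then have "bounded (range G)" by (auto simp: bounded_iff)
  then obtain c where "\<And>z. G z = c" using Liouville_theorem[OF G] by (auto simp: constant_on_def)
  then show ?thesis by simp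
qed

section \<open>Gaussian integrals and their Fourier transforms\<close>

lemma borel_measurable_cis [measurable]: "cis \<in> borel_measurable borel"
  by (intro borel_measurable_continuous_onI continuous_intros)

lemma lborel_integral_affine:
  fixes f :: "'a::euclidean_space \<Rightarrow> 'b::{banach, second_countable_topology}"
  assumes [measurable]: "f \<in> borel_measurable borel" and c: "c \<noteq> 0"
  shows "(\<integral>x. f x \<partial>lborel) = \<bar>c\<bar> ^ DIM('a) *\<^sub>R (\<integral>x. f (t + c *\<^sub>R x) \<partial>lborel)"
  by (subst lborel_affine[OF c, of t])
    (simp add: integral_density integral_distr)

lemma lborel_integrable_translation:
  fixes f :: "'a::euclidean_space \<Rightarrow> 'b::{banach, second_countable_topology}"
  assumes "integrable lborel f"
  shows "integrable lborel (\<lambda>x. f (t + x))"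
proof -
  have "integrable (distr lborel borel ((+) t)) f" using assms by (simp add: lborel_distr_plus)
  then show ?thesis by (subst (asm) integrable_distr_eq) (use assms in auto)
qed

lemma lborel_prod_Basis:
  fixes f :: "'a::euclidean_space \<Rightarrow> real \<Rightarrow> 'b::{real_normed_field, banach, second_countable_topology}"
  assumes f: "\<And>b. b \<in> Basis \<Longrightarrow> integrable lborel (f b)"
  shows integrable_lborel_prod_Basis: "integrable lborel (\<lambda>x. \<Prod>b\<in>Basis. f b (x \<bullet> b))"
    and integral_lborel_prod_Basis:
      "(\<integral>x. (\<Prod>b\<in>Basis. f b (x \<bullet> b)) \<partial>lborel) = (\<Prod>b\<in>Basis. \<integral>t. f b t \<partial>lborel)"
proof -
  interpret product_sigma_finite "\<lambda>b::'a. lborel :: real measure" ..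
  have [measurable]: "b \<in> Basis \<Longrightarrow> f b \<in> borel_measurable borel" for b
    using borel_measurable_integrable[OF f] by simp
  have T: "(\<lambda>f. \<Sum>b\<in>Basis. f b *\<^sub>R b) \<in> (\<Pi>\<^sub>M b\<in>Basis. lborel) \<rightarrow>\<^sub>M (borel :: 'a measure)"
    by measurable
  have eq: "(\<Prod>b\<in>Basis. f b ((\<Sum>c\<in>Basis. g c *\<^sub>R c) \<bullet> b)) = (\<Prod>b\<in>Basis. f b (g b))" for g
    by (intro prod.cong refl) (simp add: inner_sum_left inner_Basis if_distrib cong: if_cong)
  show "integrable lborel (\<lambda>x. \<Prod>b\<in>Basis. f b (x \<bullet> b))"
    by (subst lborel_eq, subst integrable_distr_eq[OF T]) 
       (simp_all add: eq product_integrable_prod f)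
  show "(\<integral>x. (\<Prod>b\<in>Basis. f b (x \<bullet> b)) \<partial>lborel) = (\<Prod>b\<in>Basis. \<integral>t. f b t \<partial>lborel)"
    by (subst lborel_eq, subst integral_distr[OF T]) 
       (simp_all add: eq product_integral_prod f)
qed

text \<open>
  This is the characteristic function of the standard normal distribution after a dilation by
  \<open>sqrt (2 * a)\<close>.
\<close>

lemma gaussian_fourier_real:
  fixes a w :: real
  assumes a: "a > 0"
  shows "integrable lborel (\<lambda>x::real. of_real (exp (- a * x\<^sup>2)) * cis (- (x * w)))"
    and "(\<integral>x. of_real (exp (- a * x\<^sup>2)) * cis (- (x * w)) \<partial>lborel)
         = complex_of_real (sqrt (pi / a) * exp (- w\<^sup>2 / (4 * a)))"
proof -
  define c where "c = sqrt (2 * a)"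
  have c: "c > 0" "c * c = 2 * a" using a by (auto simp: c_def)
  let ?f = "\<lambda>t x. complex_of_real (std_normal_density x) * cis (t * x)"
  have int: "integrable lborel (?f t)" for t
  proof (rule Bochner_Integration.integrable_bound)
    show "integrable lborel std_normal_density" by simp
  qed (auto simp: norm_mult)
  have val: "(\<integral>x. ?f t x \<partial>lborel) = of_real (exp (- (t\<^sup>2) / 2))" for t
    using fun_cong[OF char_std_normal_distribution, of t]
    unfolding char_def
    by (subst (asm) integral_density) (auto simp: scaleR_conv_of_real cis_conv_exp mult_ac)
  have eq: "?f (- w / c) (0 + c * x) = of_real (1 / sqrt (2 * pi)) * (of_real (exp (- a * x\<^sup>2)) * cis (- (x * w)))" for x
  proof -
    have "(c * x)\<^sup>2 / 2 = a * x\<^sup>2" using c by (simp add: power2_eq_square algebra_simps)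
    then show ?thesis using c by (simp add: std_normal_density_def mult_ac)
  qed
  have "integrable lborel (\<lambda>x. ?f (- w / c) (0 + c * x))"
    using c by (intro lborel_integrable_real_affine int) auto
  then have "integrable lborel (\<lambda>x. of_real (sqrt (2 * pi)) * ?f (- w / c) (0 + c * x))"
    by (rule integrable_mult_right)
  then show "integrable lborel (\<lambda>x::real. of_real (exp (- a * x\<^sup>2)) * cis (- (x * w)))"
    unfolding eq by simp
  have "of_real (exp (- ((- w / c)\<^sup>2) / 2)) = \<bar>c\<bar> *\<^sub>R (\<integral>x. ?f (- w / c) (0 + c * x) \<partial>lborel)"
    unfolding val[symmetric] using c by (intro lborel_integral_real_affine) auto
  also have "\<dots> = complex_of_real (c / sqrt (2 * pi)) * (\<integral>x. of_real (exp (- a * x\<^sup>2)) * cis (- (x * w)) \<partial>lborel)"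
    unfolding eq using c by (simp add: scaleR_conv_of_real)
  finally have "(\<integral>x. of_real (exp (- a * x\<^sup>2)) * cis (- (x * w)) \<partial>lborel)
    = complex_of_real (sqrt (2 * pi) / c * exp (- ((- w / c)\<^sup>2) / 2))"
    using c by (simp add: field_simps)
  also have "sqrt (2 * pi) / c = sqrt (pi / a)" by (simp add: c_def flip: real_sqrt_divide)
  also have "(- w / c)\<^sup>2 / 2 = w\<^sup>2 / (4 * a)" using c by (simp add: power2_eq_square field_simps)
  then have "- ((- w / c)\<^sup>2) / 2 = - w\<^sup>2 / (4 * a)" by simp
  finally show "(\<integral>x. of_real (exp (- a * x\<^sup>2)) * cis (- (x * w)) \<partial>lborel)
         = complex_of_real (sqrt (pi / a) * exp (- w\<^sup>2 / (4 * a)))" .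
qed

lemma
  fixes w :: "'a::euclidean_space"
  assumes a: "a > 0"
  shows integrable_gaussian_cis: "integrable lborel (\<lambda>x::'a. of_real (exp (- a * (norm x)\<^sup>2)) * cis (- (x \<bullet> w)))"
    and gaussian_fourier: "(\<integral>x. of_real (exp (- a * (norm x)\<^sup>2)) * cis (- (x \<bullet> w)) \<partial>lborel)
         = complex_of_real (sqrt (pi / a) ^ DIM('a) * exp (- (norm w)\<^sup>2 / (4 * a)))"
proof -
  have sq: "(norm x)\<^sup>2 = (\<Sum>b\<in>Basis. (x \<bullet> b)\<^sup>2)" for x :: 'a
    by (subst power2_norm_eq_inner, subst euclidean_inner) (simp add: power2_eq_square)
  have cis_sum: "cis (\<Sum>b\<in>A. g b) = (\<Prod>b\<in>A. cis (g b))" for A :: "'a set" and g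
    by (induction A rule: infinite_finite_induct) (auto simp: cis_mult[symmetric])
  have eq: "of_real (exp (- a * (norm x)\<^sup>2)) * cis (- (x \<bullet> w))
    = (\<Prod>b\<in>Basis. of_real (exp (- a * (x \<bullet> b)\<^sup>2)) * cis (- ((x \<bullet> b) * (w \<bullet> b))))" for x :: 'a
    by (subst euclidean_inner)
      (simp add: sq sum_distrib_left exp_sum prod.distrib cis_sum flip: sum_negf)
  show "integrable lborel (\<lambda>x::'a. of_real (exp (- a * (norm x)\<^sup>2)) * cis (- (x \<bullet> w)))"
    unfolding eq by (intro integrable_lborel_prod_Basis gaussian_fourier_real a)
  show "(\<integral>x. of_real (exp (- a * (norm x)\<^sup>2)) * cis (- (x \<bullet> w)) \<partial>lborel)
         = complex_of_real (sqrt (pi / a) ^ DIM('a) * exp (- (norm w)\<^sup>2 / (4 * a)))"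
    unfolding eq integral_lborel_prod_Basis[OF gaussian_fourier_real(1)[OF a]] gaussian_fourier_real(2)[OF a]
    by (simp add: sq prod.distrib exp_sum sum_divide_distrib flip: sum_negf)
qed

lemma integrable_gaussian:
  fixes a :: real
  assumes "a > 0"
  shows "integrable lborel (\<lambda>x::'a::euclidean_space. exp (- a * (norm x)\<^sup>2))"
  using integrable_norm[OF integrable_gaussian_cis[OF assms, of "0::'a"]] by simp

lemma integral_gaussian:
  fixes a :: real
  assumes "a > 0"
  shows "(\<integral>x. exp (- a * (norm x)\<^sup>2) \<partial>(lborel :: 'a::euclidean_space measure)) = sqrt (pi / a) ^ DIM('a)"
  using gaussian_fourier[OF assms, of "0::'a"] by (simp flip: of_real_power of_real_mult)

section \<open>Injectivity of the Fourier transform on integrable functions\<close>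

text \<open>
  The form of Fubini's theorem that suits kernels: the bounded factor \<open>k\<close> does not affect the
  integrability of \<open>f x * g y\<close>.
\<close>

lemma lborel_swap_integrals:
  fixes f :: "'a::euclidean_space \<Rightarrow> complex" and g :: "'b::euclidean_space \<Rightarrow> complex"
  assumes f: "integrable lborel f" and g: "integrable lborel g"
    and k: "(\<lambda>(x, y). k x y) \<in> borel_measurable (lborel \<Otimes>\<^sub>M lborel)"
    and bound: "\<And>x y. norm (k x y) \<le> 1"
  shows "(\<integral>x. f x * (\<integral>y. g y * k x y \<partial>lborel) \<partial>lborel) = (\<integral>y. g y * (\<integral>x. f x * k x y \<partial>lborel) \<partial>lborel)"
proof -
  interpret lborel_pair: pair_sigma_finite "lborel :: 'a measure" "lborel :: 'b measure" ..
  have [measurable]: "f \<in> borel_measurable borel" "g \<in> borel_measurable borel"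
    using f g by (auto dest: borel_measurable_integrable)
  note k[measurable]
  have tensor: "integrable (lborel \<Otimes>\<^sub>M lborel) (\<lambda>(x, y). f x * g y)"
  proof (rule lborel_pair.Fubini_integrable)
    show "integrable lborel (\<lambda>x. \<integral>y. norm (case (x, y) of (x, y) \<Rightarrow> f x * g y) \<partial>lborel)"
      using f by (simp add: norm_mult)
    show "AE x in lborel. integrable lborel (\<lambda>y. case (x, y) of (x, y) \<Rightarrow> f x * g y)"
      using g by simp
  qed measurable
  have "integrable (lborel \<Otimes>\<^sub>M lborel) (\<lambda>(x, y). f x * g y * k x y)"
  proof (rule Bochner_Integration.integrable_bound[OF tensor])
    show "(\<lambda>(x, y). f x * g y * k x y) \<in> borel_measurable (lborel \<Otimes>\<^sub>M lborel)"
      unfolding split_beta' using k by (intro borel_measurable_times) (auto simp: split_beta')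
    show "AE p in lborel \<Otimes>\<^sub>M lborel. norm (case p of (x, y) \<Rightarrow> f x * g y * k x y) \<le> norm (case p of (x, y) \<Rightarrow> f x * g y)"
      by (intro AE_I2) (auto simp: norm_mult mult_le_cancel_left1 bound split: prod.splits intro!: mult_left_le)
  qed
  from lborel_pair.Fubini_integral[OF this]
  have "(\<integral>x. (\<integral>y. f x * (g y * k x y) \<partial>lborel) \<partial>lborel) = (\<integral>y. (\<integral>x. g y * (f x * k x y) \<partial>lborel) \<partial>lborel)"
    by (simp add: mult_ac)
  then show ?thesis by simp
qed

context
  fixes h :: "'a::euclidean_space \<Rightarrow> complex"
  assumes h: "integrable lborel h"
    and h0: "\<And>w. (\<integral>x. h x * cis (- (x \<bullet> w)) \<partial>lborel) = 0"
begin

text \<open>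
  A Gaussian centred at \<open>v\<close> is a superposition of characters, each of which integrates to \<open>0\<close>
  against \<open>h\<close>.
\<close>

lemma gaussian_mean_eq_0:
  assumes s: "s > 0"
  shows "(\<integral>x. h x * of_real (exp (- s * (norm (x - v))\<^sup>2)) \<partial>lborel) = 0"
proof -
  define \<gamma> where "\<gamma> = 1 / (4 * s)"
  have \<gamma>: "\<gamma> > 0" using s by (simp add: \<gamma>_def)
  define K where "K = sqrt (pi / \<gamma>) ^ DIM('a)"
  have K: "K \<noteq> 0" using \<gamma> by (simp add: K_def)
  let ?g = "\<lambda>\<xi>. of_real (exp (- \<gamma> * (norm \<xi>)\<^sup>2)) * cis (- (\<xi> \<bullet> (- v)))"
  have inner: "(\<integral>\<xi>. ?g \<xi> * cis (- (x \<bullet> \<xi>)) \<partial>lborel) = of_real K * of_real (exp (- s * (norm (x - v))\<^sup>2))" for x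
  proof -
    have "?g \<xi> * cis (- (x \<bullet> \<xi>)) = of_real (exp (- \<gamma> * (norm \<xi>)\<^sup>2)) * cis (- (\<xi> \<bullet> (x - v)))" for \<xi>
      by (simp add: mult.assoc cis_mult inner_diff_right inner_commute)
    moreover have "- (norm (x - v))\<^sup>2 / (4 * \<gamma>) = - s * (norm (x - v))\<^sup>2"
      using s by (simp add: \<gamma>_def)
    ultimately show ?thesis
      by (simp only: gaussian_fourier[OF \<gamma>] K_def of_real_mult)
  qed
  have meas: "(\<lambda>(x, \<xi>). cis (- (x \<bullet> \<xi>))) \<in> borel_measurable (lborel \<Otimes>\<^sub>M (lborel :: 'a measure))"
    unfolding split_beta' by measurable
  have "of_real K * (\<integral>x. h x * of_real (exp (- s * (norm (x - v))\<^sup>2)) \<partial>lborel)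
      = (\<integral>x. h x * (\<integral>\<xi>. ?g \<xi> * cis (- (x \<bullet> \<xi>)) \<partial>lborel) \<partial>lborel)"
    unfolding inner by (subst integral_mult_right_zero[symmetric]) (simp add: mult_ac)
  also have "\<dots> = (\<integral>\<xi>. ?g \<xi> * (\<integral>x. h x * cis (- (x \<bullet> \<xi>)) \<partial>lborel) \<partial>lborel)"
    by (rule lborel_swap_integrals[OF h integrable_gaussian_cis[OF \<gamma>] meas]) simp
  also have "\<dots> = 0" by (simp add: h0)
  finally show ?thesis using K by simp
qed

text \<open>
  The indicator of a box, smoothed at scale \<open>c\<close>, is a superposition of Gaussians of width \<open>c\<close>
  centred at the points of the box. Writing the smoothing as an average over \<open>x + c u\<close> makes the limit \<open>c \<rightarrow> 0\<close>
  accessible to dominated convergence.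
\<close>

lemma mollified_box_eq_0:
  assumes c: "c > 0"
  shows "(\<integral>x. h x * of_real (\<integral>u. indicator (box l r) (x + c *\<^sub>R u) * exp (- (norm u)\<^sup>2) \<partial>lborel) \<partial>lborel) = 0"
proof -
  let ?e = "\<lambda>x v. exp (- (1 / c\<^sup>2) * (norm (x - v))\<^sup>2)"
  have aff: "(\<integral>v. indicator (box l r) v * ?e x v \<partial>lborel)
      = c ^ DIM('a) * (\<integral>u. indicator (box l r) (x + c *\<^sub>R u) * exp (- (norm u)\<^sup>2) \<partial>lborel)" for x :: 'a
    using c by (subst lborel_integral_affine[where c = c and t = x]) (auto simp: power_mult_distrib)
  have "integrable lborel (indicator (box l r) :: 'a \<Rightarrow> real)"
    using emeasure_lborel_box_finite[of l r] by (simp add: integrable_indicator_iff)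
  from integrable_of_real[OF this]
  have box: "integrable lborel (indicator (box l r) :: 'a \<Rightarrow> complex)"
    by (simp add: of_real_indicator)
  have meas: "(\<lambda>(x, v). complex_of_real (?e x v)) \<in> borel_measurable (lborel \<Otimes>\<^sub>M (lborel :: 'a measure))"
    unfolding split_beta' by measurable
  have "of_real (c ^ DIM('a)) * (\<integral>x. h x * of_real (\<integral>u. indicator (box l r) (x + c *\<^sub>R u) * exp (- (norm u)\<^sup>2) \<partial>lborel) \<partial>lborel)
     = (\<integral>x. h x * of_real (\<integral>v. indicator (box l r) v * ?e x v \<partial>lborel) \<partial>lborel)"
    unfolding aff by (subst integral_mult_right_zero[symmetric]) (simp add: mult_ac)
  also have "\<dots> = (\<integral>x. h x * (\<integral>v. indicator (box l r) v * of_real (?e x v) \<partial>lborel) \<partial>lborel)"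
    by (simp add: of_real_indicator flip: integral_complex_of_real)
  also have "\<dots> = (\<integral>v. indicator (box l r) v * (\<integral>x. h x * of_real (?e x v) \<partial>lborel) \<partial>lborel)"
    by (rule lborel_swap_integrals[OF h box meas]) simp
  also have "\<dots> = 0" using c by (subst gaussian_mean_eq_0) auto
  finally show ?thesis using c by simp
qed

text \<open>
  As the scale tends to \<open>0\<close>, the smoothed indicators converge off the frontier of the box, which is
  a null set.
\<close>

lemma box_integral_eq_0: "(\<integral>x. indicator (box l r) x *\<^sub>R h x \<partial>lborel) = 0"
proof -
  note [measurable] = borel_measurable_integrable[OF h]
  define K where "K = (\<integral>u. exp (- (norm u)\<^sup>2) \<partial>(lborel :: 'a measure))"
  have gi: "integrable lborel (\<lambda>u::'a. exp (- (norm u)\<^sup>2))" using integrable_gaussian[of 1] by simp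
  have K: "K \<noteq> 0" using integral_gaussian[of 1, where 'a = 'a] by (simp add: K_def)
  define \<phi> where "\<phi> k x = (\<integral>u. indicator (box l r) (x + (1 / real (Suc k)) *\<^sub>R u) * exp (- (norm u)\<^sup>2) \<partial>(lborel :: 'a measure))" for k x
  have lim: "(\<lambda>k. \<phi> k x) \<longlonglongrightarrow> indicator (box l r) x * K" if x: "x \<notin> frontier (box l r)" for x
  proof -
    have "(\<lambda>k. \<phi> k x) \<longlonglongrightarrow> (\<integral>u. indicator (box l r) x * exp (- (norm u)\<^sup>2) \<partial>(lborel :: 'a measure))"
      unfolding \<phi>_def
    proof (rule integral_dominated_convergence[where w = "\<lambda>u. exp (- (norm u)\<^sup>2)"])
      show "AE u in lborel. (\<lambda>k. indicator (box l r) (x + (1 / real (Suc k)) *\<^sub>R u) * exp (- (norm u)\<^sup>2))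
        \<longlonglongrightarrow> indicator (box l r) x * exp (- (norm u)\<^sup>2)"
      proof (intro AE_I2 tendsto_mult tendsto_const)
        fix u :: 'a
        have "(\<lambda>k. x + (1 / real (Suc k)) *\<^sub>R u) \<longlonglongrightarrow> x + 0 *\<^sub>R u"
          by (intro tendsto_intros LIMSEQ_Suc lim_1_over_n)
        moreover have "isCont (indicator (box l r) :: 'a \<Rightarrow> real) x"
          using x by (simp add: isCont_indicator)
        ultimately show "(\<lambda>k. indicator (box l r) (x + (1 / real (Suc k)) *\<^sub>R u) :: real) \<longlonglongrightarrow> indicator (box l r) x"
          by (intro isCont_tendsto_compose[where g = "indicator (box l r)"]) auto
      qed
      show "AE u in lborel. norm (indicator (box l r) (x + (1 / real (Suc k)) *\<^sub>R u) * exp (- (norm u)\<^sup>2)) \<le> exp (- (norm u)\<^sup>2)" for k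
        by (auto simp: indicator_def)
    qed (use gi in measurable)
    then show ?thesis by (simp add: K_def)
  qed
  have bound: "\<bar>\<phi> k x\<bar> \<le> K" for k x
    unfolding \<phi>_def K_def by (rule integral_abs_bound[THEN order_trans], rule integral_mono') (use gi in \<open>auto simp: indicator_def abs_mult\<close>)
  have meas [measurable]: "\<phi> k \<in> borel_measurable borel" for k
    unfolding \<phi>_def by measurable
  have "(\<lambda>k. \<integral>x. h x * of_real (\<phi> k x) \<partial>lborel) \<longlonglongrightarrow> (\<integral>x. h x * of_real (indicator (box l r) x * K) \<partial>lborel)"
  proof (rule integral_dominated_convergence[where w = "\<lambda>x. norm (h x) * K"])
    have "frontier (box l r) \<in> null_sets (lebesgue :: 'a measure)"
      by (simp add: negligible_convex_frontier flip: negligible_iff_null_sets)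
    then have "AE x in lebesgue. x \<notin> frontier (box l r)" by (rule AE_not_in)
    then have "AE x in lborel. x \<notin> frontier (box l r)" by (simp add: AE_completion_iff)
    then show "AE x in lborel. (\<lambda>k. h x * complex_of_real (\<phi> k x)) \<longlonglongrightarrow> h x * of_real (indicator (box l r) x * K)"
      by eventually_elim (intro tendsto_intros lim)
    show "AE x in lborel. norm (h x * complex_of_real (\<phi> k x)) \<le> norm (h x) * K" for k
      using bound by (auto simp: norm_mult intro!: mult_left_mono)
  qed (use h in \<open>auto\<close>)
  moreover have "(\<integral>x. h x * of_real (\<phi> k x) \<partial>lborel) = 0" for k
    unfolding \<phi>_def by (rule mollified_box_eq_0) simp
  ultimately have "(\<integral>x. h x * of_real (indicator (box l r) x * K) \<partial>lborel) = 0"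
    using LIMSEQ_unique[OF _ tendsto_const] by simp
  then have "of_real K * (\<integral>x. indicator (box l r) x *\<^sub>R h x \<partial>lborel) = 0"
    by (subst integral_mult_right_zero[symmetric]) (simp add: scaleR_conv_of_real mult_ac)
  then show ?thesis using K by simp
qed

text \<open>
  Boxes are stable under intersection and generate the Borel sets, so all integrals of \<open>h\<close> over
  Borel sets vanish.
\<close>

lemma fourier_eq_0_imp_AE_eq_0: "AE x in lborel. h x = 0"
proof (rule sigma_finite_measure.density_zero[OF sigma_finite_lborel h])
  fix A :: "'a set" assume "A \<in> sets lborel"
  let ?G = "range (\<lambda>(a, b). box a b :: 'a set)"
  have sig: "sigma_sets UNIV ?G = sets lborel" by (simp add: borel_eq_box)
  have "Int_stable ?G" "?G \<subseteq> Pow UNIV" "A \<in> sigma_sets UNIV ?G"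
    using sig \<open>A \<in> sets lborel\<close> by (auto simp: Int_stable_def box_Int_box)
  then show "set_lebesgue_integral lborel A h = 0"
  proof (induction rule: sigma_sets_induct_disjoint)
    case (basic A)
    then show "set_lebesgue_integral lborel A h = 0"
      using box_integral_eq_0 by (auto simp: set_lebesgue_integral_def)
  next
    case empty
    show ?case by (simp add: set_lebesgue_integral_def)
  next
    case (compl A)
    then have [measurable]: "A \<in> sets borel" using sig by simp
    have "(\<integral>x. indicator (UNIV - A) x *\<^sub>R h x \<partial>lborel) = (\<integral>x. h x - indicator A x *\<^sub>R h x \<partial>lborel)"
      by (intro Bochner_Integration.integral_cong) (auto simp: indicator_def)
    also have "\<dots> = (\<integral>x. h x \<partial>lborel) - (\<integral>x. indicator A x *\<^sub>R h x \<partial>lborel)"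
      using h by (intro Bochner_Integration.integral_diff integrable_mult_indicator) auto
    finally show "set_lebesgue_integral lborel (UNIV - A) h = 0"
      \<comment> \<open>The integral of \<open>h\<close> over the whole space is its transform at \<open>0\<close>.\<close>
      using compl(2) h0[of 0] by (simp add: set_lebesgue_integral_def)
  next
    case (union A)
    then have "A i \<in> sets lborel" for i using sig by auto
    moreover have "set_integrable lborel (\<Union>i. A i) h"
      unfolding set_integrable_def using calculation h by (intro integrable_mult_indicator) auto
    ultimately show "set_lebesgue_integral lborel (\<Union>i. A i) h = 0"
      using union by (subst lebesgue_integral_countable_add) (auto simp: disjoint_family_on_def)
  qed
qed

end

section \<open>Hardy's theorem for complex functions on a Euclidean space\<close>

text \<open>
  Completing the square turns the tilted Gaussian into a multiple of a translated one. The
  exponent \<open>y\<^sup>2 |w|\<^sup>2 / (4 a)\<close> that this produces is the origin of the critical value \<open>1/4\<close>.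
\<close>

lemma
  fixes w :: "'a::euclidean_space"
  assumes a: "a > 0"
  shows integrable_tilted_gaussian: "integrable lborel (\<lambda>x. exp (- a * (norm x)\<^sup>2) * exp (y * (x \<bullet> w)))"
    and integral_tilted_gaussian: "(\<integral>x. exp (- a * (norm x)\<^sup>2) * exp (y * (x \<bullet> w)) \<partial>lborel)
      = sqrt (pi / a) ^ DIM('a) * exp (y\<^sup>2 * (norm w)\<^sup>2 / (4 * a))"
proof -
  define v where "v = - (y / (2 * a)) *\<^sub>R w"
  have eq: "exp (- a * (norm x)\<^sup>2) * exp (y * (x \<bullet> w))
      = exp (y\<^sup>2 * (norm w)\<^sup>2 / (4 * a)) * exp (- a * (norm (v + x))\<^sup>2)" for x
    using a unfolding v_def power2_norm_eq_inner exp_add[symmetric]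
    by (simp add: inner_simps inner_commute power2_eq_square field_simps)
  show "integrable lborel (\<lambda>x. exp (- a * (norm x)\<^sup>2) * exp (y * (x \<bullet> w)))"
    unfolding eq by (intro integrable_mult_right lborel_integrable_translation integrable_gaussian a)
  have "(\<integral>x. exp (- a * (norm (v + x))\<^sup>2) \<partial>lborel) = (\<integral>x. exp (- a * (norm x)\<^sup>2) \<partial>(lborel :: 'a measure))"
    by (subst (2) lborel_integral_affine[where c = 1 and t = v]) auto
  then show "(\<integral>x. exp (- a * (norm x)\<^sup>2) * exp (y * (x \<bullet> w)) \<partial>lborel)
      = sqrt (pi / a) ^ DIM('a) * exp (y\<^sup>2 * (norm w)\<^sup>2 / (4 * a))"
    unfolding eq integral_mult_right_zero integral_gaussian[OF a] by (simp only: mult.commute)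
qed

lemma entire_if_power_series:
  fixes F :: "complex \<Rightarrow> complex"
  assumes "\<And>z. (\<lambda>n. c n * z ^ n) sums F z"
  shows "F holomorphic_on UNIV"
proof -
  have "F holomorphic_on (\<Union>n. ball 0 (real n))"
    by (intro holomorphic_on_UN_open power_series_holomorphic[where a = c]) (use assms in auto)
  moreover have "(\<Union>n. ball 0 (real n)) = (UNIV :: complex set)"
    using reals_Archimedean2 by auto
  ultimately show ?thesis by simp
qed

context
  fixes g :: "'a::euclidean_space \<Rightarrow> complex" and a C :: real
  assumes g [measurable]: "g \<in> borel_measurable borel" and a: "a > 0"
    and decay: "AE x in lborel. norm (g x) \<le> C * exp (- a * (norm x)\<^sup>2)"
begin

lemma integrable_tilted:
  "integrable lborel (\<lambda>x. norm (g x) * exp (y * (x \<bullet> w)))"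
proof (rule Bochner_Integration.integrable_bound)
  show "integrable lborel (\<lambda>x. C * (exp (- a * (norm x)\<^sup>2) * exp (y * (x \<bullet> w))))"
    by (intro integrable_mult_right integrable_tilted_gaussian a)
  show "AE x in lborel. norm (norm (g x) * exp (y * (x \<bullet> w)))
      \<le> norm (C * (exp (- a * (norm x)\<^sup>2) * exp (y * (x \<bullet> w))))"
    using decay
  proof eventually_elim
    case (elim x)
    have "norm (g x) \<le> \<bar>C\<bar> * exp (- a * (norm x)\<^sup>2)" 
      by (rule order_trans[OF elim]) (simp add: mult_right_mono)
    then show ?case by (simp add: abs_mult mult.assoc[symmetric] mult_right_mono)
  qed
qed measurable

lemma integrable_decaying: "integrable lborel g"
  using integrable_tilted[of 0 0] by (subst integrable_norm_iff[symmetric]) auto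

text \<open>
  The Fourier transform of \<open>g\<close> along the line spanned by \<open>w\<close>, with a complex parameter.
\<close>

definition fourier_laplace :: "'a \<Rightarrow> complex \<Rightarrow> complex" where
  "fourier_laplace w z = (\<integral>x. g x * exp (- (\<i> * z * of_real (x \<bullet> w))) \<partial>lborel)"

lemma fourier_laplace_real: "fourier_laplace w (of_real t) = (\<integral>x. g x * cis (- (x \<bullet> (t *\<^sub>R w))) \<partial>lborel)"
  by (simp add: fourier_laplace_def cis_conv_exp mult_ac)

text \<open>
  The exponential series may be integrated term by term, since the series of absolute values sums to
  \<open>norm (g x) * exp (norm z * \<bar>x \<bullet> w\<bar>)\<close>, which is integrable by the Gaussian decay of \<open>g\<close>.
\<close>

lemma fourier_laplace_entire: "fourier_laplace w holomorphic_on UNIV"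
proof (rule entire_if_power_series)
  fix z
  define f where "f n x = g x * ((- (\<i> * z * of_real (x \<bullet> w))) ^ n /\<^sub>R fact n)" for n x
  have nf: "norm (f n x) = norm (g x) * ((norm z * \<bar>x \<bullet> w\<bar>) ^ n /\<^sub>R fact n)" for n x
    by (simp add: f_def norm_mult norm_power)
  have expo: "(\<lambda>n. norm (f n x)) sums (norm (g x) * exp (norm z * \<bar>x \<bullet> w\<bar>))" for x
    unfolding nf by (intro sums_mult exp_converges)
  have maj: "integrable lborel (\<lambda>x. norm (g x) * exp (norm z * \<bar>x \<bullet> w\<bar>))"
  proof (rule Bochner_Integration.integrable_bound)
    show "integrable lborel (\<lambda>x. norm (g x) * exp (norm z * (x \<bullet> w)) + norm (g x) * exp (- norm z * (x \<bullet> w)))"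
      by (intro Bochner_Integration.integrable_add integrable_tilted)
    have "norm (g x) * exp (norm z * \<bar>x \<bullet> w\<bar>)
        \<le> norm (g x) * exp (norm z * (x \<bullet> w)) + norm (g x) * exp (- norm z * (x \<bullet> w))" for x
      by (cases "x \<bullet> w \<ge> 0") auto
    then show "AE x in lborel. norm (norm (g x) * exp (norm z * \<bar>x \<bullet> w\<bar>))
        \<le> norm (norm (g x) * exp (norm z * (x \<bullet> w)) + norm (g x) * exp (- norm z * (x \<bullet> w)))"
      by (auto simp: abs_mult)
  qed measurable
  have sum_le: "(\<Sum>i<n. norm (f i x)) \<le> norm (g x) * exp (norm z * \<bar>x \<bullet> w\<bar>)" for n x
    using expo[of x] by (metis finite_lessThan norm_ge_zero sum_le_suminf sums_iff)
  have fm [measurable]: "f n \<in> borel_measurable borel" for n unfolding f_def by measurable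
  have fi: "integrable lborel (f n)" for n
  proof (rule Bochner_Integration.integrable_bound[OF maj])
    have "norm (f n x) \<le> (\<Sum>i<Suc n. norm (f i x))" for x by (simp add: sum_nonneg)
    then have "norm (f n x) \<le> norm (g x) * exp (norm z * \<bar>x \<bullet> w\<bar>)" for x
      using sum_le order_trans by blast
    then show "AE x in lborel. norm (f n x) \<le> norm (norm (g x) * exp (norm z * \<bar>x \<bullet> w\<bar>))" by simp
  qed measurable
  have "summable (\<lambda>n. \<integral>x. norm (f n x) \<partial>lborel)"
  proof (rule summableI_nonneg_bounded)
    fix n
    have "(\<Sum>i<n. \<integral>x. norm (f i x) \<partial>lborel) = (\<integral>x. (\<Sum>i<n. norm (f i x)) \<partial>lborel)"
      using fi by (intro Bochner_Integration.integral_sum[symmetric]) auto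
    also have "\<dots> \<le> (\<integral>x. norm (g x) * exp (norm z * \<bar>x \<bullet> w\<bar>) \<partial>lborel)"
      using fi maj sum_le by (intro integral_mono Bochner_Integration.integrable_sum) auto
    finally show "(\<Sum>i<n. \<integral>x. norm (f i x) \<partial>lborel) \<le> (\<integral>x. norm (g x) * exp (norm z * \<bar>x \<bullet> w\<bar>) \<partial>lborel)" .
  qed simp
  then have "(\<lambda>n. \<integral>x. f n x \<partial>lborel) sums (\<integral>x. (\<Sum>n. f n x) \<partial>lborel)"
    using expo by (intro sums_integral fi) (auto simp: sums_iff)
  also have "(\<lambda>x. \<Sum>n. f n x) = (\<lambda>x. g x * exp (- (\<i> * z * of_real (x \<bullet> w))))"
    unfolding f_def by (intro ext sums_unique[symmetric] sums_mult exp_converges)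
  also have "(\<lambda>n. \<integral>x. f n x \<partial>lborel) = (\<lambda>n. (\<integral>x. g x * ((- (\<i> * of_real (x \<bullet> w))) ^ n /\<^sub>R fact n) \<partial>lborel) * z ^ n)"
  proof
    fix n
    have "f n x = g x * ((- (\<i> * of_real (x \<bullet> w))) ^ n /\<^sub>R fact n) * z ^ n" for x
      by (simp add: f_def power_mult_distrib[symmetric] mult_ac)
    then show "(\<integral>x. f n x \<partial>lborel) = (\<integral>x. g x * ((- (\<i> * of_real (x \<bullet> w))) ^ n /\<^sub>R fact n) \<partial>lborel) * z ^ n"
      by simp
  qed
  finally show "(\<lambda>n. (\<integral>x. g x * ((- (\<i> * of_real (x \<bullet> w))) ^ n /\<^sub>R fact n) \<partial>lborel) * z ^ n) sums fourier_laplace w z"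
    by (simp add: fourier_laplace_def)
qed

lemma norm_fourier_laplace_le:
  "norm (fourier_laplace w z) \<le> C * sqrt (pi / a) ^ DIM('a) * exp ((Im z)\<^sup>2 * (norm w)\<^sup>2 / (4 * a))"
proof -
  have n: "norm (g x * exp (- (\<i> * z * of_real (x \<bullet> w)))) = norm (g x) * exp (Im z * (x \<bullet> w))" for x
    by (simp add: norm_mult)
  have "norm (fourier_laplace w z) \<le> (\<integral>x. norm (g x) * exp (Im z * (x \<bullet> w)) \<partial>lborel)"
    unfolding fourier_laplace_def n[symmetric] by (rule integral_norm_bound)
  also have "\<dots> \<le> (\<integral>x. C * (exp (- a * (norm x)\<^sup>2) * exp (Im z * (x \<bullet> w))) \<partial>lborel)"
  proof (rule integral_mono_AE)
    show "AE x in lborel. norm (g x) * exp (Im z * (x \<bullet> w)) \<le> C * (exp (- a * (norm x)\<^sup>2) * exp (Im z * (x \<bullet> w)))"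
      using decay by eventually_elim (simp add: mult.assoc[symmetric])
  qed (intro integrable_tilted integrable_mult_right integrable_tilted_gaussian a)+
  also have "\<dots> = C * sqrt (pi / a) ^ DIM('a) * exp ((Im z)\<^sup>2 * (norm w)\<^sup>2 / (4 * a))"
    by (simp only: integral_mult_right_zero integral_tilted_gaussian[OF a] mult.assoc)
  finally show ?thesis .
qed

text \<open>
  The heart of the theorem. Multiplication by \<open>exp (b * z\<^sup>2)\<close> undoes the decay of the transform on the
  real axis, and at the same time trades its growth in \<open>Im z\<close> for growth in \<open>Re z\<close>; the
  result is constant.
\<close>

lemma fourier_eq_gaussian:
  assumes decay_hat: "\<And>y. norm (\<integral>x. g x * cis (- (x \<bullet> y)) \<partial>lborel) \<le> C' * exp (- (norm y)\<^sup>2 / (4 * a))"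
  shows "(\<integral>x. g x * cis (- (x \<bullet> w)) \<partial>lborel) = (\<integral>x. g x \<partial>lborel) * of_real (exp (- (norm w)\<^sup>2 / (4 * a)))"
proof -
  define b where "b = (norm w)\<^sup>2 / (4 * a)"
  have b: "b \<ge> 0" using a by (simp add: b_def)
  define D where "D = max C' (C * sqrt (pi / a) ^ DIM('a))"
  define G where "G z = fourier_laplace w z * exp (of_real b * z\<^sup>2)" for z
  have nG: "norm (G z) = norm (fourier_laplace w z) * exp (b * ((Re z)\<^sup>2 - (Im z)\<^sup>2))" for z
    by (simp add: G_def norm_mult power2_eq_square)
  have "G 1 = G 0"
  proof (rule critical_growth_constant[where G = G and a = b and C = D])
    show "G holomorphic_on UNIV" unfolding G_def
      by (intro holomorphic_intros fourier_laplace_entire)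
    show "norm (G z) \<le> D * exp (b * (Re z)\<^sup>2)" for z
    proof -
      have "norm (fourier_laplace w z) \<le> C * sqrt (pi / a) ^ DIM('a) * exp (b * (Im z)\<^sup>2)"
        using norm_fourier_laplace_le[of w z] by (simp add: b_def mult_ac)
      also have "\<dots> \<le> D * exp (b * (Im z)\<^sup>2)" by (simp add: D_def)
      finally have "norm (G z) \<le> D * exp (b * (Im z)\<^sup>2) * exp (b * ((Re z)\<^sup>2 - (Im z)\<^sup>2))"
        unfolding nG by (intro mult_right_mono) auto
      then show ?thesis by (simp add: mult.assoc right_diff_distrib flip: exp_add)
    qed
    show "norm (G (of_real t)) \<le> D" for t
    proof -
      have "norm (fourier_laplace w (of_real t)) \<le> C' * exp (- (norm (t *\<^sub>R w))\<^sup>2 / (4 * a))"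
        unfolding fourier_laplace_real by (rule decay_hat)
      also have "- (norm (t *\<^sub>R w))\<^sup>2 / (4 * a) = - (b * t\<^sup>2)" by (simp add: b_def power_mult_distrib)
      also have "C' * exp (- (b * t\<^sup>2)) \<le> D * exp (- (b * t\<^sup>2))" by (simp add: D_def)
      finally have "norm (G (of_real t)) \<le> D * exp (- (b * t\<^sup>2)) * exp (b * t\<^sup>2)"
        unfolding nG by (simp add: mult_right_mono)
      then show ?thesis by (simp add: mult.assoc flip: exp_add)
    qed
  qed (fact b)
  then have "fourier_laplace w (of_real 1) * of_real (exp b) = fourier_laplace w (of_real 0)"
    by (simp add: G_def exp_of_real)
  then have "(\<integral>x. g x * cis (- (x \<bullet> w)) \<partial>lborel) * of_real (exp b) = (\<integral>x. g x \<partial>lborel)"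
    unfolding fourier_laplace_real by simp
  then show ?thesis by (simp add: b_def exp_minus field_simps)
qed

text \<open>
  The constant \<open>A\<close> is fixed by the transform at \<open>0\<close>: it makes the integral of the Gaussian equal to
  that of \<open>g\<close>.
\<close>

theorem hardy_critical:
  assumes decay_hat: "\<And>y. norm (\<integral>x. g x * cis (- (x \<bullet> y)) \<partial>lborel) \<le> C' * exp (- (norm y)\<^sup>2 / (4 * a))"
  shows "\<exists>A. AE x in lborel. g x = of_real (exp (- a * (norm x)\<^sup>2)) * A"
proof -
  define K where "K = sqrt (pi / a) ^ DIM('a)"
  have K: "K > 0" using a by (simp add: K_def)
  define A where "A = (\<integral>x. g x \<partial>lborel) / of_real K"
  define h where "h x = g x - A * of_real (exp (- a * (norm x)\<^sup>2))" for x
  have bd: "integrable lborel (\<lambda>x. u x * cis (- (x \<bullet> w)))" if "integrable lborel u" for u :: "'a \<Rightarrow> complex" and w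
  proof (rule Bochner_Integration.integrable_bound[OF that])
    have [measurable]: "u \<in> borel_measurable borel" using borel_measurable_integrable[OF that] by simp
    show "(\<lambda>x. u x * cis (- (x \<bullet> w))) \<in> borel_measurable lborel" by measurable
  qed (simp add: norm_mult)
  have gi: "integrable lborel (\<lambda>x::'a. complex_of_real (exp (- a * (norm x)\<^sup>2)))"
    by (intro integrable_of_real integrable_gaussian a)
  have "AE x in lborel. h x = 0"
  proof (rule fourier_eq_0_imp_AE_eq_0)
    show "integrable lborel h" unfolding h_def
      by (intro Bochner_Integration.integrable_diff integrable_mult_right gi integrable_decaying)
    show "(\<integral>x. h x * cis (- (x \<bullet> w)) \<partial>lborel) = 0" for w
    proof -
      have "h x * cis (- (x \<bullet> w)) = g x * cis (- (x \<bullet> w)) - A * (of_real (exp (- a * (norm x)\<^sup>2)) * cis (- (x \<bullet> w)))" for x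
        by (simp add: h_def algebra_simps)
      then have "(\<integral>x. h x * cis (- (x \<bullet> w)) \<partial>lborel) = (\<integral>x. g x * cis (- (x \<bullet> w)) \<partial>lborel)
          - A * (\<integral>x. of_real (exp (- a * (norm x)\<^sup>2)) * cis (- (x \<bullet> w)) \<partial>lborel)"
        by (simp only: Bochner_Integration.integral_diff[OF bd[OF integrable_decaying]
            integrable_mult_right[OF integrable_gaussian_cis[OF a]]] integral_mult_right_zero)
      then show ?thesis
        unfolding fourier_eq_gaussian[OF decay_hat] gaussian_fourier[OF a]
        using K by (simp add: A_def flip: K_def)
    qed
  qed
  then have "AE x in lborel. g x = of_real (exp (- a * (norm x)\<^sup>2)) * A"
    by eventually_elim (simp add: h_def mult.commute)
  then show ?thesis by blast
qed

end

section \<open>The Clifford Fourier transform of a Gaussian\<close>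

lemma bounded_linear_cl_mult_left: "bounded_linear (\<lambda>M. cl_mult p M N)"
  using linear_cl_mult_left by (simp add: linear_conv_bounded_linear)

lemma cl_mult_kernel:
  "cl_mult p M (cl_kernel i \<theta>) = cos \<theta> *\<^sub>R M - sin \<theta> *\<^sub>R cl_mult p M i"
  by (simp add: cl_kernel_def linear_diff[OF linear_cl_mult_right] linear_cmul[OF linear_cl_mult_right]
      cl_mult_one_right)

lemma cl_fourier_gaussian:
  fixes A i :: "'n::{finite,linorder} clifford"
  assumes \<gamma>: "\<gamma> > 0"
  shows "cl_fourier p i (\<lambda>x. exp (- \<gamma> * (norm x)\<^sup>2) *\<^sub>R A) w
    = (sqrt (pi / \<gamma>) ^ CARD('n) * exp (- (norm w)\<^sup>2 / (4 * \<gamma>))) *\<^sub>R A"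
proof -
  let ?e = "\<lambda>x::'n coords. exp (- \<gamma> * (norm x)\<^sup>2)"
  let ?F = "\<lambda>x::'n coords. of_real (?e x) * cis (- (x \<bullet> w))"
  note F = integrable_gaussian_cis[OF \<gamma>, of w] gaussian_fourier[OF \<gamma>, of w]
  have c: "integrable lborel (\<lambda>x. ?e x * cos (x \<bullet> w))"
      "(\<integral>x. ?e x * cos (x \<bullet> w) \<partial>lborel) = sqrt (pi / \<gamma>) ^ CARD('n) * exp (- (norm w)\<^sup>2 / (4 * \<gamma>))"
    using integrable_Re[OF F(1)] integral_Re[OF F(1), unfolded F(2)] by simp_all
  have s: "integrable lborel (\<lambda>x. ?e x * sin (x \<bullet> w))" "(\<integral>x. ?e x * sin (x \<bullet> w) \<partial>lborel) = 0"
    using integrable_Im[OF F(1)] integral_Im[OF F(1), unfolded F(2)] by simp_all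
  have "cl_fourier p i (\<lambda>x. ?e x *\<^sub>R A) w
      = (\<integral>x. (?e x * cos (x \<bullet> w)) *\<^sub>R A - (?e x * sin (x \<bullet> w)) *\<^sub>R cl_mult p A i \<partial>lebesgue)"
    unfolding cl_fourier_def cl_mult_kernel cl_phase_eq_inner
    by (simp add: linear_cmul[OF linear_cl_mult_left] mult.commute)
  also have "\<dots> = (\<integral>x. (?e x * cos (x \<bullet> w)) *\<^sub>R A - (?e x * sin (x \<bullet> w)) *\<^sub>R cl_mult p A i \<partial>lborel)"
    by (rule integral_completion) measurable
  also have "\<dots> = (sqrt (pi / \<gamma>) ^ CARD('n) * exp (- (norm w)\<^sup>2 / (4 * \<gamma>))) *\<^sub>R A"
    using c s by (subst Bochner_Integration.integral_diff) (auto intro!: integrable_scaleR_left)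
  finally show ?thesis .
qed

text \<open>
  The two bounds on \<open>\<gamma>\<close> correspond to the two estimates, since the transform of \<open>e\<^bsup>-\<gamma>|x|\<^sup>2\<^esup>\<close> decays
  like \<open>e\<^bsup>-|y|\<^sup>2/(4\<gamma>)\<^esup>\<close>.
\<close>

lemma hardy_estimates_gaussian:
  fixes A i :: "'n::{finite,linorder} clifford"
  assumes "\<alpha> > 0" "\<beta> > 0" "\<alpha> \<le> \<gamma>" "\<gamma> \<le> 1 / (4 * \<beta>)"
  shows "hardy_estimates p i \<alpha> \<beta> (\<lambda>x. exp (- \<gamma> * (norm x)\<^sup>2) *\<^sub>R A)"
proof -
  have \<gamma>: "\<gamma> > 0" using assms by simp
  define K where "K = sqrt (pi / \<gamma>) ^ CARD('n)"
  have K: "K \<ge> 0" using \<gamma> by (simp add: K_def)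
  define C where "C = 1 + norm A + K * norm A"
  have \<beta>: "\<beta> \<le> 1 / (4 * \<gamma>)" using assms \<gamma> by (simp add: field_simps)
  have "exp (- \<gamma> * (norm x)\<^sup>2) * norm A \<le> C * exp (- \<alpha> * (norm x)\<^sup>2)" for x :: "'n coords"
  proof -
    have "exp (- \<gamma> * (norm x)\<^sup>2) * norm A \<le> exp (- \<alpha> * (norm x)\<^sup>2) * C"
      using assms K by (intro mult_mono) (auto simp: C_def mult_right_mono)
    then show ?thesis by (simp add: mult.commute)
  qed
  moreover have "K * exp (- (norm y)\<^sup>2 / (4 * \<gamma>)) * norm A \<le> C * exp (- \<beta> * (norm y)\<^sup>2)" for y :: "'n coords"
  proof -
    have "\<beta> * (norm y)\<^sup>2 \<le> (norm y)\<^sup>2 / (4 * \<gamma>)" using mult_right_mono[OF \<beta>, of "(norm y)\<^sup>2"] by simp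
    then have "(K * norm A) * exp (- (norm y)\<^sup>2 / (4 * \<gamma>)) \<le> C * exp (- \<beta> * (norm y)\<^sup>2)"
      using K by (intro mult_mono) (auto simp: C_def)
    then show ?thesis by (simp add: mult_ac)
  qed
  moreover have "C > 0" using K by (simp add: C_def add_pos_nonneg)
  moreover have "(\<lambda>x::'n coords. exp (- \<gamma> * (norm x)\<^sup>2) *\<^sub>R A) \<in> borel_measurable lebesgue"
    by (rule measurable_completion) measurable
  ultimately show ?thesis
    unfolding hardy_estimates_def cl_modulus_eq_norm cl_fourier_gaussian[OF \<gamma>]
    using K by (auto simp: K_def[symmetric] intro!: exI[of _ C])
qed

section \<open>Reduction of the Clifford transform to the complex one\<close>

lemma complex_lebesgue_ex_borel:
  fixes f :: "'a::euclidean_space \<Rightarrow> complex"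
  assumes f: "f \<in> borel_measurable lebesgue"
  obtains g where "g \<in> borel_measurable borel" "AE x in lborel. f x = g x"
proof -
  have "(\<lambda>x. Re (f x)) \<in> borel_measurable lebesgue" "(\<lambda>x. Im (f x)) \<in> borel_measurable lebesgue"
    using f by auto
  from this[THEN completion_ex_borel_measurable_real] obtain u v where uv [measurable]: "u \<in> borel_measurable lborel" "v \<in> borel_measurable lborel"
    and AE: "AE x in lborel. Re (f x) = u x" "AE x in lborel. Im (f x) = v x"
    by blast
  show ?thesis
  proof
    show "(\<lambda>x. Complex (u x) (v x)) \<in> borel_measurable borel"
      using uv unfolding Complex_eq by simp
    show "AE x in lborel. f x = Complex (u x) (v x)"
      using AE by eventually_elim (simp add: complex_eq_iff)
  qed
qed

text \<open>
  The coefficients of \<open>f\<close> are treated one at a time. The map \<open>\<Phi>\<close> in the proof intertwines right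
  multiplication by \<open>i\<close> with multiplication by \<open>\<i>\<close>; this follows from \<open>i\<^sup>2 = - 1\<close> and
  associativity.
\<close>

lemma hardy_estimates_critical:
  fixes i :: "'n::{finite,linorder} clifford"
  assumes i: "cl_mult p i i = - cl_one" and \<alpha>: "\<alpha> > 0" and crit: "\<alpha> * \<beta> = 1/4"
    and f: "hardy_estimates p i \<alpha> \<beta> f"
  shows "\<exists>A. AE x in lebesgue. f x = exp (- \<alpha> * (norm x)\<^sup>2) *\<^sub>R A"
proof -
  from f obtain C where fm [measurable]: "f \<in> borel_measurable lebesgue"
    and decay: "\<And>x. norm (f x) \<le> C * exp (- \<alpha> * (norm x)\<^sup>2)"
    and decay_hat: "\<And>y. norm (cl_fourier p i f y) \<le> C * exp (- \<beta> * (norm y)\<^sup>2)"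
    and C: "C > 0"
    unfolding hardy_estimates_def cl_modulus_eq_norm by blast
  have \<beta>: "\<beta> = 1 / (4 * \<alpha>)" using crit \<alpha> by (simp add: field_simps)
  define T where "T M w x = cl_mult p (M x) (cl_kernel i (x \<bullet> w))" for M :: "'n coords \<Rightarrow> 'n clifford" and w x
  have fi: "integrable lebesgue f"
  proof (rule Bochner_Integration.integrable_bound[OF _ fm])
    show "integrable lebesgue (\<lambda>x::'n coords. C * exp (- \<alpha> * (norm x)\<^sup>2))"
      by (subst integrable_completion) (auto intro!: integrable_gaussian[OF \<alpha>, simplified])
  qed (use decay C in auto)
  have Ti: "integrable lebesgue (T f w)" for w
  proof -
    have *: "integrable lebesgue (\<lambda>x. t (x \<bullet> w) *\<^sub>R N x)"
      if t: "t \<in> borel_measurable borel" "\<And>s. \<bar>t s\<bar> \<le> 1" and N: "integrable lebesgue N"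
      for t :: "real \<Rightarrow> real" and N :: "'n coords \<Rightarrow> 'n clifford"
    proof (rule Bochner_Integration.integrable_bound[OF N])
      have "(\<lambda>x. t (x \<bullet> w)) \<in> borel_measurable lebesgue"
        by (rule measurable_completion) (use t(1) in measurable)
      then show "(\<lambda>x. t (x \<bullet> w) *\<^sub>R N x) \<in> borel_measurable lebesgue"
        by (rule borel_measurable_scaleR[OF _ borel_measurable_integrable[OF N]])
    qed (use t(2) in \<open>auto intro!: AE_I2 mult_left_le_one_le\<close>)
    show ?thesis unfolding T_def cl_mult_kernel
      by (intro Bochner_Integration.integrable_diff * integrable_bounded_linear[OF bounded_linear_cl_mult_left] fi)
        auto
  qed
  have coord: "\<exists>c. AE x in lebesgue. f x $ A = exp (- \<alpha> * (norm x)\<^sup>2) * c" for A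
  proof -
    define \<Phi> where "\<Phi> M = Complex (M $ A) (- (cl_mult p M i $ A))" for M
    have \<Phi>: "bounded_linear \<Phi>"
      unfolding \<Phi>_def
      by (rule linear_conv_bounded_linear[THEN iffD1], rule linearI)
        (simp_all add: complex_eq_iff linear_add[OF linear_cl_mult_left] linear_cmul[OF linear_cl_mult_left])
    obtain B where B: "\<And>M. norm (\<Phi> M) \<le> norm M * B" "B > 0"
      using bounded_linear.pos_bounded[OF \<Phi>] by blast
    have \<Phi>_kernel: "\<Phi> (cl_mult p M (cl_kernel i \<theta>)) = \<Phi> M * cis (- \<theta>)" for M \<theta>
    proof -
      have "cl_mult p (cl_mult p M (cl_kernel i \<theta>)) i = cos \<theta> *\<^sub>R cl_mult p M i + sin \<theta> *\<^sub>R M"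
        by (simp add: cl_mult_kernel linear_diff[OF linear_cl_mult_left] linear_cmul[OF linear_cl_mult_left]
            cl_mult_assoc i linear_neg[OF linear_cl_mult_right] cl_mult_one_right)
      then show ?thesis
        by (simp add: \<Phi>_def cl_mult_kernel complex_eq_iff algebra_simps)
    qed
    have "(\<lambda>x. \<Phi> (f x)) \<in> borel_measurable lebesgue"
      by (intro borel_measurable_integrable integrable_bounded_linear[OF \<Phi>] fi)
    \<comment> \<open>Hardy's theorem above is about Borel functions, so \<open>\<Phi> \<circ> f\<close> is changed on a null set.\<close>
    then obtain g where g [measurable]: "g \<in> borel_measurable borel" and fg: "AE x in lborel. \<Phi> (f x) = g x"
      by (rule complex_lebesgue_ex_borel)
    have hat: "(\<integral>x. g x * cis (- (x \<bullet> w)) \<partial>lborel) = \<Phi> (cl_fourier p i f w)" for w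
    proof -
      have "\<Phi> (cl_fourier p i f w) = (\<integral>x. \<Phi> (T f w x) \<partial>lebesgue)"
        unfolding cl_fourier_def cl_phase_eq_inner T_def[symmetric]
        by (rule integral_bounded_linear[OF \<Phi> Ti, symmetric])
      also have "\<dots> = (\<integral>x. g x * cis (- (x \<bullet> w)) \<partial>lebesgue)"
      proof (rule integral_cong_AE)
        show "(\<lambda>x. \<Phi> (T f w x)) \<in> borel_measurable lebesgue"
          by (intro borel_measurable_integrable integrable_bounded_linear[OF \<Phi>] Ti)
        show "(\<lambda>x. g x * cis (- (x \<bullet> w))) \<in> borel_measurable lebesgue"
          by (rule measurable_completion) measurable
        have "AE x in lebesgue. \<Phi> (f x) = g x" using fg by (rule AE_completion)
        then show "AE x in lebesgue. \<Phi> (T f w x) = g x * cis (- (x \<bullet> w))"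
          by eventually_elim (simp add: T_def \<Phi>_kernel)
      qed
      also have "\<dots> = (\<integral>x. g x * cis (- (x \<bullet> w)) \<partial>lborel)"
        by (rule integral_completion) measurable
      finally show ?thesis by simp
    qed
    have "\<exists>c. AE x in lborel. g x = of_real (exp (- \<alpha> * (norm x)\<^sup>2)) * c"
    proof (rule hardy_critical[OF g \<alpha>])
      show "AE x in lborel. norm (g x) \<le> C * B * exp (- \<alpha> * (norm x)\<^sup>2)"
        using fg
      proof eventually_elim
        case (elim x)
        have "norm (f x) * B \<le> C * exp (- \<alpha> * (norm x)\<^sup>2) * B" using decay B by (intro mult_right_mono) auto
        then show ?case using B(1)[of "f x"] elim by (simp add: mult_ac)
      qed
      show "norm (\<integral>x. g x * cis (- (x \<bullet> y)) \<partial>lborel) \<le> C * B * exp (- (norm y)\<^sup>2 / (4 * \<alpha>))" for y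
      proof -
        have "norm (cl_fourier p i f y) * B \<le> C * exp (- \<beta> * (norm y)\<^sup>2) * B"
          using decay_hat B by (intro mult_right_mono) auto
        then show ?thesis unfolding hat using B(1)[of "cl_fourier p i f y"] by (simp add: \<beta> mult_ac)
      qed
    qed
    then obtain c where c: "AE x in lborel. g x = of_real (exp (- \<alpha> * (norm x)\<^sup>2)) * c" by blast
    have "AE x in lborel. f x $ A = exp (- \<alpha> * (norm x)\<^sup>2) * Re c"
      using fg c
    proof eventually_elim
      case (elim x)
      have "f x $ A = Re (\<Phi> (f x))" by (simp add: \<Phi>_def)
      then show ?case using elim by simp
    qed
    then show ?thesis by (blast intro: AE_completion)
  qed
  then have "\<forall>A. \<exists>c. AE x in lebesgue. f x $ A = exp (- \<alpha> * (norm x)\<^sup>2) * c" ..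
  from choice[OF this] obtain c
    where c: "\<forall>A. AE x in lebesgue. f x $ A = exp (- \<alpha> * (norm x)\<^sup>2) * c A" ..
  have "AE x in lebesgue. \<forall>A\<in>UNIV. f x $ A = exp (- \<alpha> * (norm x)\<^sup>2) * c A"
    by (rule AE_finite_allI[OF finite]) (rule spec[OF c])
  then have "AE x in lebesgue. f x = exp (- \<alpha> * (norm x)\<^sup>2) *\<^sub>R (\<chi> A. c A)"
    by eventually_elim (simp add: vec_eq_iff)
  then show ?thesis by blast
qed

text \<open>
  Lowering \<open>\<beta>\<close> to the critical value \<open>1 / (4 \<alpha>)\<close> makes \<open>f\<close> a Gaussian whose transform is known at
  every point, so the stronger decay can be tested at points \<open>y\<close> with \<open>|y| \<rightarrow> \<infinity>\<close>.
\<close>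

lemma hardy_estimates_supercritical:
  fixes i :: "'n::{finite,linorder} clifford"
  assumes i: "cl_mult p i i = - cl_one" and \<alpha>: "\<alpha> > 0" and super: "\<alpha> * \<beta> > 1/4"
    and f: "hardy_estimates p i \<alpha> \<beta> f"
  shows "AE x in lebesgue. f x = 0"
proof -
  from f obtain C where fm [measurable]: "f \<in> borel_measurable lebesgue"
    and decay: "\<And>x. norm (f x) \<le> C * exp (- \<alpha> * (norm x)\<^sup>2)"
    and decay_hat: "\<And>y. norm (cl_fourier p i f y) \<le> C * exp (- \<beta> * (norm y)\<^sup>2)"
    and C: "C > 0"
    unfolding hardy_estimates_def cl_modulus_eq_norm by blast
  define \<beta>' where "\<beta>' = 1 / (4 * \<alpha>)"
  have \<beta>': "\<alpha> * \<beta>' = 1/4" "\<beta>' < \<beta>" using \<alpha> super by (auto simp: \<beta>'_def field_simps)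
  have "C * exp (- \<beta> * (norm y)\<^sup>2) \<le> C * exp (- \<beta>' * (norm y)\<^sup>2)" for y :: "'n coords"
    using C \<beta>' by (simp add: mult_right_mono)
  then have "hardy_estimates p i \<alpha> \<beta>' f"
    unfolding hardy_estimates_def cl_modulus_eq_norm
    using fm decay decay_hat C by (meson order_trans)
  from hardy_estimates_critical[OF i \<alpha> \<beta>'(1) this]
  obtain A where A: "AE x in lebesgue. f x = exp (- \<alpha> * (norm x)\<^sup>2) *\<^sub>R A" by blast
  have cm: "(\<lambda>x. cl_mult p (M x) (cl_kernel i (x \<bullet> y))) \<in> borel_measurable lebesgue"
    if M: "M \<in> borel_measurable lebesgue" for M :: "'n coords \<Rightarrow> 'n clifford" and y
  proof -
    have "(\<lambda>x. cl_mult p (M x) i) \<in> borel_measurable lebesgue"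
      by (rule measurable_compose[OF M])
        (intro borel_measurable_continuous_onI linear_continuous_on bounded_linear_cl_mult_left)
    moreover have "(\<lambda>x. cos (x \<bullet> y)) \<in> borel_measurable lebesgue" "(\<lambda>x. sin (x \<bullet> y)) \<in> borel_measurable lebesgue"
      by (rule measurable_completion, measurable)+
    ultimately show ?thesis unfolding cl_mult_kernel using M by measurable
  qed
  have eq: "cl_fourier p i f y = (sqrt (pi / \<alpha>) ^ CARD('n) * exp (- \<beta>' * (norm y)\<^sup>2)) *\<^sub>R A" for y
  proof -
    have "cl_fourier p i f y = cl_fourier p i (\<lambda>x. exp (- \<alpha> * (norm x)\<^sup>2) *\<^sub>R A) y"
      unfolding cl_fourier_def cl_phase_eq_inner
    proof (rule integral_cong_AE)
      show "(\<lambda>x. cl_mult p (exp (- \<alpha> * (norm x)\<^sup>2) *\<^sub>R A) (cl_kernel i (x \<bullet> y))) \<in> borel_measurable lebesgue"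
        by (rule cm, rule measurable_completion) measurable
      show "AE x in lebesgue. cl_mult p (f x) (cl_kernel i (x \<bullet> y))
        = cl_mult p (exp (- \<alpha> * (norm x)\<^sup>2) *\<^sub>R A) (cl_kernel i (x \<bullet> y))"
        using A by eventually_elim simp
    qed (rule cm[OF fm])
    also have "\<dots> = (sqrt (pi / \<alpha>) ^ CARD('n) * exp (- (norm y)\<^sup>2 / (4 * \<alpha>))) *\<^sub>R A"
      by (rule cl_fourier_gaussian[OF \<alpha>])
    finally show ?thesis by (simp add: \<beta>'_def)
  qed
  define K where "K = sqrt (pi / \<alpha>) ^ CARD('n)"
  have K: "K > 0" using \<alpha> by (simp add: K_def)
  have "K * norm A \<le> C * exp (- (\<beta> - \<beta>') * r\<^sup>2)" if r: "r \<ge> 0" for r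
  proof -
    obtain y :: "'n coords" where y: "norm y = r" using vector_choose_size[OF r] by blast
    have "exp (- \<beta>' * r\<^sup>2) * (K * norm A) \<le> C * exp (- \<beta> * r\<^sup>2)"
      using decay_hat[of y] K y by (simp add: eq mult_ac flip: K_def)
    also have "\<dots> = exp (- \<beta>' * r\<^sup>2) * (C * exp (- (\<beta> - \<beta>') * r\<^sup>2))"
      by (simp add: algebra_simps flip: exp_add)
    finally show ?thesis by simp
  qed
  moreover have "((\<lambda>r. C * exp (- (\<beta> - \<beta>') * r\<^sup>2)) \<longlongrightarrow> 0) at_top"
  proof -
    have "\<beta> - \<beta>' > 0" using \<beta>' by simp
    then have "((\<lambda>r. exp (- (\<beta> - \<beta>') * r\<^sup>2)) \<longlongrightarrow> 0) at_top" by real_asymp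
    then show ?thesis by (rule tendsto_mult_right_zero)
  qed
  ultimately have "K * norm A \<le> 0"
    by (intro tendsto_lowerbound[where F = "at_top :: real filter"])
      (auto intro: eventually_mono[OF eventually_ge_at_top[of 0]])
  then have "A = 0" using K by (simp add: mult_le_0_iff)
  with A show ?thesis by simp
qed

lemma gaussians_not_AE_eq:
  fixes A :: "'b::real_normed_vector"
  assumes "\<gamma> \<noteq> \<delta>" "A \<noteq> 0"
  shows "\<not> (AE x in (lebesgue :: 'a::euclidean_space measure). 
    exp (- \<gamma> * (norm x)\<^sup>2) *\<^sub>R A = exp (- \<delta> * (norm x)\<^sup>2) *\<^sub>R A)"
proof
  assume "AE x in (lebesgue :: 'a measure). exp (- \<gamma> * (norm x)\<^sup>2) *\<^sub>R A = exp (- \<delta> * (norm x)\<^sup>2) *\<^sub>R A"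
  moreover have "AE x in (lebesgue :: 'a measure). x \<noteq> 0"
    by (rule AE_completion) (rule AE_lborel_singleton)
  ultimately have "AE x in (lebesgue :: 'a measure). False"
    by eventually_elim (use assms in simp)
  then show False by (simp add: eventually_False ae_filter_eq_bot_iff)
qed

section \<open>The three regimes\<close>

theorem theorem4p5:
  fixes p q :: nat and i :: "'n::{finite,linorder} clifford" and \<alpha> \<beta> :: real
  assumes "CARD('n) = p + q"
    and "cl_mult p i i = - cl_one" and "cl_reverse p i = - i"
    and "\<alpha> > 0" and "\<beta> > 0"
  shows "(\<alpha> * \<beta> > 1/4 \<longrightarrow>
            (\<forall>f. hardy_estimates p i \<alpha> \<beta> f \<longrightarrow> (AE x in lebesgue. f x = 0)))
       \<and> (\<alpha> * \<beta> = 1/4 \<longrightarrow>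
            (\<forall>f. hardy_estimates p i \<alpha> \<beta> f \<longrightarrow>
              (\<exists>A. AE x in lebesgue. f x = exp (- \<alpha> * (norm x)\<^sup>2) *\<^sub>R A)))
       \<and> (\<alpha> * \<beta> < 1/4 \<longrightarrow>
            (\<exists>S. infinite S \<and> (\<forall>f\<in>S. hardy_estimates p i \<alpha> \<beta> f) \<and>
              (\<forall>f\<in>S. \<forall>g\<in>S. f \<noteq> g \<longrightarrow> \<not> (AE x in lebesgue. f x = g x))))"
proof (intro conjI impI allI)
  fix f assume "\<alpha> * \<beta> > 1/4" "hardy_estimates p i \<alpha> \<beta> f"
  then show "AE x in lebesgue. f x = 0"
    using assms by (intro hardy_estimates_supercritical)
next
  fix f assume "\<alpha> * \<beta> = 1/4" "hardy_estimates p i \<alpha> \<beta> f"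
  then show "\<exists>A. AE x in lebesgue. f x = exp (- \<alpha> * (norm x)\<^sup>2) *\<^sub>R A"
    using assms by (intro hardy_estimates_critical)
next
  assume "\<alpha> * \<beta> < 1/4"
  then have lt: "\<alpha> < 1 / (4 * \<beta>)" using assms by (simp add: field_simps)
  define F :: "real \<Rightarrow> 'n coords \<Rightarrow> 'n clifford"
    where "F \<gamma> x = exp (- \<gamma> * (norm x)\<^sup>2) *\<^sub>R cl_one" for \<gamma> x
  have "(cl_one :: 'n clifford) \<noteq> 0"
    by (simp add: vec_eq_iff cl_one_def cl_basis_nth)
  then have distinct: "\<not> (AE x in lebesgue. F \<gamma> x = F \<delta> x)" if "\<gamma> \<noteq> \<delta>" for \<gamma> \<delta>
    unfolding F_def using that by (intro gaussians_not_AE_eq)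
  then have "inj F" by (metis (mono_tags, lifting) AE_I2 injI)
  then have "infinite (F ` {\<alpha>..1 / (4 * \<beta>)})"
    using lt by (subst finite_image_iff) (auto intro: inj_on_subset)
  moreover have "hardy_estimates p i \<alpha> \<beta> (F \<gamma>)" if "\<gamma> \<in> {\<alpha>..1 / (4 * \<beta>)}" for \<gamma>
    unfolding F_def using that assms by (intro hardy_estimates_gaussian) auto
  ultimately show "\<exists>S. infinite S \<and> (\<forall>f\<in>S. hardy_estimates p i \<alpha> \<beta> f) \<and>
      (\<forall>f\<in>S. \<forall>g\<in>S. f \<noteq> g \<longrightarrow> \<not> (AE x in lebesgue. f x = g x))"
    using distinct by (intro exI[of _ "F ` {\<alpha>..1 / (4 * \<beta>)}"]) (auto, metis)
qed

end
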